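(* Let $p<0$, $\alpha>0$, $q<\frac{\alpha}{n+\alpha}$, and let $\mu$ be a non-zero finite even Borel measure on $S^{n-1}$ that vanishes on all great subspheres. Define $\varphi(f)=-\frac1p\int_{S^{n-1}}f^p\,d\mu$. Then for every $c\in(0,1)$ there exists $K\in\mathcal{K}_e^n$ with $G_{\alpha,q}(K)=c$ such that \[\varphi(h_K)=\sup\{\varphi(f): f\in C_e^+(S^{n-1}),\ G_{\alpha,q}([f])=c\}.\]
   Context: $C_e^+(S^{n-1})$: even positive continuous functions on $S^{n-1}$; $[f]=\{x: x\cdot v\le f(v)\ \forall v\in S^{n-1}\}$; $h_K$ support function. $\mathcal{K}_e^n$: origin-symmetric convex bodies containing the origin in their interior. $g_{\alpha,q}(x)=\frac{1}{Z(\alpha,q)}[1-\frac{q}{\alpha}|x|^\alpha]_+^{\frac1q-\frac n\alpha-1}$ ($q\ne0$), $\frac{1}{Z(\alpha,q)}e^{-|x|^\alpha/\alpha}$ ($q=0$), normalized to mass 1; $G_{\alpha,q}(K)=\int_Kg_{\alpha,q}$. $\mu$ vanishes on all great subspheres: $\mu(S^{n-1}\cap H)=0$ for every proper linear subspace $H$. *)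

theory Defs
  imports "HOL-Analysis.Analysis"
begin

text \<open>Unit sphere S^{n-1} in the Euclidean space 'a, n = DIM('a).\<close>
abbreviation Sph :: "'a::euclidean_space set" where
  "Sph \<equiv> sphere 0 1"

text \<open>Even positive continuous functions on the sphere (values off the sphere are irrelevant).\<close>
definition Ce_plus :: "('a::euclidean_space \<Rightarrow> real) set" where
  "Ce_plus = {f. continuous_on Sph f \<and> (\<forall>v\<in>Sph. f v > 0) \<and> (\<forall>v\<in>Sph. f (- v) = f v)}"

text \<open>Wulff shape [f].\<close>
definition wulff :: "('a::euclidean_space \<Rightarrow> real) \<Rightarrow> 'a set" where
  "wulff f = {x. \<forall>v\<in>Sph. x \<bullet> v \<le> f v}"

text \<open>Support function.\<close>
definition supp_fun :: "'a::euclidean_space set \<Rightarrow> 'a \<Rightarrow> real" where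
  "supp_fun K v = (SUP x\<in>K. x \<bullet> v)"

text \<open>Origin-symmetric convex bodies with the origin in the interior.\<close>
definition Ke :: "'a::euclidean_space set set" where
  "Ke = {K. compact K \<and> convex K \<and> 0 \<in> interior K \<and> uminus ` K = K}"

text \<open>Unnormalized density of g_{alpha,q}.\<close>
definition g_raw :: "real \<Rightarrow> real \<Rightarrow> 'a::euclidean_space \<Rightarrow> real" where
  "g_raw \<alpha> q x =
     (if q = 0 then exp (- (norm x powr \<alpha>) / \<alpha>)
      else (max 0 (1 - q / \<alpha> * norm x powr \<alpha>))
             powr (1 / q - real DIM('a) / \<alpha> - 1))"

definition Zc :: "real \<Rightarrow> real \<Rightarrow> 'a::euclidean_space itself \<Rightarrow> real" where
  "Zc \<alpha> q _ = (LINT x|(lborel :: 'a measure). g_raw \<alpha> q x)"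

definition g_dens :: "real \<Rightarrow> real \<Rightarrow> 'a::euclidean_space \<Rightarrow> real" where
  "g_dens \<alpha> q x = g_raw \<alpha> q x / Zc \<alpha> q TYPE('a)"

definition Gmeas :: "real \<Rightarrow> real \<Rightarrow> 'a::euclidean_space set \<Rightarrow> real" where
  "Gmeas \<alpha> q K = (LINT x:K|lborel. g_dens \<alpha> q x)"

text \<open>phi(f) = -(1/p) \<integral> f^p d mu.\<close>
definition phi :: "real \<Rightarrow> 'a::euclidean_space measure \<Rightarrow> ('a \<Rightarrow> real) \<Rightarrow> real" where
  "phi p \<mu> f = - (1 / p) * (\<integral>v. f v powr p \<partial>\<mu>)"

end

theory Submission
  imports Defs "HOL-Complex_Analysis.Great_Picard"
begin

(* Replacing a feasible f by the support function of its Wulff shape keeps the constraint and,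
   as p < 0 makes \<phi> antitone, does not decrease \<phi>; so one may maximize over bodies.
   Along a maximizing sequence of bodies the inradius stays bounded below, since thin slabs have
   G-measure below c, and the bodies stay bounded, since otherwise \<phi> of their support functions
   would tend to 0 by dominated convergence, \<mu> being null on great subspheres.  Blaschke selection
   gives a limit body of G-measure at least c on which \<phi> attains the supremum; shrinking it to
   G-measure exactly c only lowers the support function and hence keeps \<phi> maximal. *)

section \<open>Wulff shapes and support functions\<close>

lemma wulff_eq_INT: "wulff f = (\<Inter>v\<in>Sph. {x. v \<bullet> x \<le> f v})"
  by (auto simp: wulff_def inner_commute)

lemma closed_wulff: "closed (wulff f)"
  unfolding wulff_eq_INT by (auto intro!: closed_INT closed_halfspace_le)

lemma convex_wulff: "convex (wulff f)"
  unfolding wulff_eq_INT by (auto intro!: convex_INT convex_halfspace_le)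

lemma cball_subset_wulff:
  assumes "\<forall>v\<in>Sph. r \<le> f v"
  shows "cball 0 r \<subseteq> wulff f"
proof
  fix x :: 'a assume "x \<in> cball 0 r"
  then have "x \<bullet> v \<le> r" if "v \<in> Sph" for v
    using norm_cauchy_schwarz[of x v] that by simp
  then show "x \<in> wulff f" using assms by (force simp: wulff_def)
qed

lemma wulff_subset_cball:
  assumes "\<forall>v\<in>Sph. f v \<le> R" "0 \<le> R"
  shows "wulff f \<subseteq> cball 0 R"
proof
  fix x :: 'a assume x: "x \<in> wulff f"
  show "x \<in> cball 0 R"
  proof (cases "x = 0")
    case False
    then have "sgn x \<in> Sph" and "x \<bullet> sgn x = norm x"
      by (simp_all add: norm_sgn sgn_div_norm dot_square_norm power2_eq_square)
    then show ?thesis using x assms(1) by (force simp: wulff_def)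
  qed (use assms in simp)
qed

lemma uminus_wulff:
  assumes "\<forall>v\<in>Sph. f (- v) = f v"
  shows "uminus ` wulff f = wulff f"
proof -
  have minus_mem: "- x \<in> wulff f" if "x \<in> wulff f" for x
    unfolding wulff_def
  proof (intro CollectI ballI)
    fix v :: 'a assume v: "v \<in> Sph"
    then have "- v \<in> Sph" by simp
    then have "x \<bullet> (- v) \<le> f (- v)" using that unfolding wulff_def by blast
    then show "(- x) \<bullet> v \<le> f v" using assms v by simp
  qed
  show ?thesis
  proof
    show "uminus ` wulff f \<subseteq> wulff f" using minus_mem by blast
    show "wulff f \<subseteq> uminus ` wulff f"
      using minus_mem by (metis image_eqI minus_minus subsetI)
  qed
qed

lemma wulff_scaleR:
  assumes "0 < t"
  shows "wulff (\<lambda>v. t * f v) = (*\<^sub>R) t ` wulff f"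
proof (intro set_eqI iffI)
  fix x :: 'a assume "x \<in> wulff (\<lambda>v. t * f v)"
  then have "(1 / t) *\<^sub>R x \<in> wulff f"
    using assms by (auto simp: wulff_def field_simps)
  moreover have "x = t *\<^sub>R ((1 / t) *\<^sub>R x)" using assms by simp
  ultimately show "x \<in> (*\<^sub>R) t ` wulff f" by (rule rev_image_eqI)
next
  fix x :: 'a assume "x \<in> (*\<^sub>R) t ` wulff f"
  then show "x \<in> wulff (\<lambda>v. t * f v)"
    using assms by (auto simp: wulff_def intro: mult_left_mono)
qed

lemma wulff_const:
  assumes "0 \<le> \<rho>"
  shows "wulff (\<lambda>v::'a::euclidean_space. \<rho>) = cball 0 \<rho>"
  using cball_subset_wulff[of \<rho> "\<lambda>_. \<rho>"] wulff_subset_cball[of "\<lambda>_. \<rho>" \<rho>] assms by auto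

lemma sphere_nonempty: "Sph \<noteq> ({} :: 'a::euclidean_space set)"
  using vector_choose_size[of 1, where 'a='a] by auto

lemma continuous_on_sphere_lower_bound:
  fixes f :: "'a::euclidean_space \<Rightarrow> real"
  assumes "continuous_on Sph f" "\<forall>v\<in>Sph. 0 < f v"
  obtains r where "0 < r" "\<forall>v\<in>Sph. r \<le> f v"
  using continuous_attains_inf[OF compact_sphere sphere_nonempty assms(1)] assms(2) by blast

lemma continuous_on_sphere_upper_bound:
  fixes f :: "'a::euclidean_space \<Rightarrow> real"
  assumes "continuous_on Sph f"
  obtains R where "\<forall>v\<in>Sph. f v \<le> R"
  using continuous_attains_sup[OF compact_sphere sphere_nonempty assms] by blast

lemma wulff_in_Ke:
  assumes "f \<in> Ce_plus"
  shows "wulff f \<in> Ke"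
proof -
  have f: "continuous_on Sph f" "\<forall>v\<in>Sph. 0 < f v" "\<forall>v\<in>Sph. f (- v) = f v"
    using assms by (auto simp: Ce_plus_def)
  obtain r where r: "0 < r" "\<forall>v\<in>Sph. r \<le> f v"
    using continuous_on_sphere_lower_bound[OF f(1,2)] .
  obtain R where R: "\<forall>v\<in>Sph. f v \<le> R"
    using continuous_on_sphere_upper_bound[OF f(1)] .
  have "0 \<le> R" using r R sphere_nonempty by fastforce
  then have "compact (wulff f)"
    using wulff_subset_cball[OF R] closed_wulff
    by (meson bounded_cball bounded_subset compact_eq_bounded_closed)
  moreover have "0 \<in> interior (wulff f)"
    using cball_subset_wulff[OF r(2)] r(1) mem_interior_cball by blast
  ultimately show ?thesis
    using convex_wulff uminus_wulff[OF f(3)] by (auto simp: Ke_def)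
qed

lemma supp_fun_upper:
  assumes "bounded K" "x \<in> K"
  shows "x \<bullet> v \<le> supp_fun K v"
proof -
  obtain M where M: "\<forall>y\<in>K. norm y \<le> M" using assms(1) bounded_iff by blast
  have "y \<bullet> v \<le> M * norm v" if "y \<in> K" for y
  proof -
    have "y \<bullet> v \<le> norm y * norm v" by (rule norm_cauchy_schwarz)
    also have "\<dots> \<le> M * norm v" using M that by (simp add: mult_right_mono)
    finally show ?thesis .
  qed
  then have "bdd_above ((\<lambda>y. y \<bullet> v) ` K)" by (intro bdd_aboveI2)
  then show ?thesis unfolding supp_fun_def using assms(2) by (rule cSUP_upper2) auto
qed

lemma supp_fun_least:
  assumes "K \<noteq> {}" "\<And>x. x \<in> K \<Longrightarrow> x \<bullet> v \<le> M"
  shows "supp_fun K v \<le> M"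
  unfolding supp_fun_def using assms by (rule cSUP_least)

lemma supp_fun_zero: "K \<noteq> {} \<Longrightarrow> supp_fun K 0 = 0"
  by (simp add: supp_fun_def)

lemma supp_fun_lipschitz:
  assumes "K \<subseteq> cball 0 R" "K \<noteq> {}"
  shows "\<bar>supp_fun K x - supp_fun K y\<bar> \<le> R * norm (x - y)"
proof -
  have "bounded K" using assms(1) bounded_cball bounded_subset by blast
  have *: "supp_fun K a \<le> supp_fun K b + R * norm (a - b)" for a b
  proof (rule supp_fun_least[OF assms(2)])
    fix z assume z: "z \<in> K"
    have "z \<bullet> a = z \<bullet> b + z \<bullet> (a - b)" by (simp add: inner_diff_right)
    also have "z \<bullet> (a - b) \<le> norm z * norm (a - b)" by (rule norm_cauchy_schwarz)
    also have "norm z * norm (a - b) \<le> R * norm (a - b)"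
      using assms(1) z by (auto intro!: mult_right_mono)
    also have "z \<bullet> b \<le> supp_fun K b" by (rule supp_fun_upper[OF \<open>bounded K\<close> z])
    finally show "z \<bullet> a \<le> supp_fun K b + R * norm (a - b)" by simp
  qed
  show ?thesis using *[of x y] *[of y x] by (simp add: norm_minus_commute abs_le_iff)
qed

lemma continuous_on_supp_fun:
  assumes "K \<subseteq> cball 0 R" "K \<noteq> {}"
  shows "continuous_on S (supp_fun K)"
proof -
  have "R-lipschitz_on S (supp_fun K)"
    using supp_fun_lipschitz[OF assms] assms
    by (intro lipschitz_onI) (auto simp: dist_norm dist_real_def)
  then show ?thesis by (rule lipschitz_on_continuous_on)
qed

lemma supp_fun_ge:
  assumes "cball 0 r \<subseteq> K" "bounded K" "v \<in> Sph" "0 \<le> r"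
  shows "r \<le> supp_fun K v"
proof -
  have "r *\<^sub>R v \<in> K" using assms by auto
  moreover have "(r *\<^sub>R v) \<bullet> v = r" using assms(3) by (simp add: dot_square_norm)
  ultimately show ?thesis using supp_fun_upper[OF assms(2)] by metis
qed

lemma supp_fun_uminus:
  assumes "uminus ` K = K"
  shows "supp_fun K (- v) = supp_fun K v"
proof -
  have "(\<lambda>x. x \<bullet> (- v)) ` K = (\<lambda>x. x \<bullet> v) ` (uminus ` K)" by (auto simp: image_image)
  then show ?thesis unfolding supp_fun_def assms by simp
qed

lemma supp_fun_wulff_le:
  assumes "wulff f \<noteq> {}" "v \<in> Sph"
  shows "supp_fun (wulff f) v \<le> f v"
  using assms by (intro supp_fun_least) (auto simp: wulff_def)

lemma wulff_supp_fun:
  assumes "compact K" "convex K" "K \<noteq> {}"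
  shows "wulff (supp_fun K) = K"
proof
  have bK: "bounded K" using assms compact_imp_bounded by blast
  show "K \<subseteq> wulff (supp_fun K)" using supp_fun_upper[OF bK] by (auto simp: wulff_def)
  show "wulff (supp_fun K) \<subseteq> K"
  proof
    fix z assume z: "z \<in> wulff (supp_fun K)"
    show "z \<in> K"
    proof (rule ccontr)
      assume "z \<notin> K"
      then obtain a b where ab: "inner a z < b" "\<forall>x\<in>K. inner a x > b"
        using separating_hyperplane_closed_point[OF assms(2) compact_imp_closed[OF assms(1)]]
        by blast
      have "a \<noteq> 0" using ab assms(3) by auto
      define v where "v = - sgn a"
      have v: "v \<in> Sph" using \<open>a \<noteq> 0\<close> by (simp add: v_def norm_sgn)
      have "supp_fun K v \<le> - b / norm a"
        using ab(2) \<open>a \<noteq> 0\<close>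
        by (intro supp_fun_least[OF assms(3)])
           (auto simp: v_def sgn_div_norm inner_commute field_simps)
      also have "- b / norm a < z \<bullet> v"
        using ab(1) \<open>a \<noteq> 0\<close> by (simp add: v_def sgn_div_norm inner_commute field_simps)
      finally show False using z v unfolding wulff_def by fastforce
    qed
  qed
qed

lemma Ke_cball_subset:
  assumes "K \<in> Ke"
  obtains r where "0 < r" "cball 0 r \<subseteq> K"
  using assms by (auto simp: Ke_def mem_interior_cball)

lemma Ke_nonempty: "K \<in> Ke \<Longrightarrow> K \<noteq> {}"
  by (auto simp: Ke_def dest: interior_subset[THEN subsetD])

lemma supp_fun_in_Ce_plus:
  assumes "K \<in> Ke"
  shows "supp_fun K \<in> Ce_plus"
proof -
  obtain r where r: "0 < r" "cball 0 r \<subseteq> K" using Ke_cball_subset[OF assms] .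
  have K: "compact K" "uminus ` K = K" using assms by (auto simp: Ke_def)
  have bK: "bounded K" using compact_imp_bounded[OF K(1)] .
  then obtain R where "K \<subseteq> cball 0 R" by (force simp: bounded_iff)
  moreover have "K \<noteq> {}" using r by auto
  ultimately have "continuous_on Sph (supp_fun K)" by (rule continuous_on_supp_fun)
  moreover have "0 < supp_fun K v" if "v \<in> Sph" for v
    using supp_fun_ge[OF r(2) bK that less_imp_le[OF r(1)]] r(1) by linarith
  ultimately show ?thesis using supp_fun_uminus[OF K(2)] by (simp add: Ce_plus_def)
qed

text \<open>Blaschke selection: support functions of uniformly bounded bodies are uniformly
  Lipschitz, so Arzela-Ascoli applies on the sphere.\<close>

lemma supp_fun_subseq_tendsto:
  fixes K :: "nat \<Rightarrow> 'a::euclidean_space set"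
  assumes "\<And>i. K i \<subseteq> cball 0 R" "\<And>i. K i \<noteq> {}"
  obtains h and \<sigma> :: "nat \<Rightarrow> nat" where "strict_mono \<sigma>" "continuous_on Sph h"
    "\<And>v. v \<in> Sph \<Longrightarrow> (\<lambda>i. supp_fun (K (\<sigma> i)) v) \<longlonglongrightarrow> h v"
proof -
  have R: "0 \<le> R" using assms(1)[of 0] assms(2)[of 0] by force
  have lip: "\<bar>supp_fun (K i) x - supp_fun (K i) y\<bar> \<le> R * norm (x - y)" for i x y
    using supp_fun_lipschitz[OF assms] .
  have bound: "norm (supp_fun (K i) v) \<le> R" if "v \<in> Sph" for i v
    using lip[of i v 0] supp_fun_zero[OF assms(2)] that by simp
  have equicont: "\<exists>d>0. \<forall>i y. y \<in> Sph \<and> norm (v - y) < d \<longrightarrow>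
      norm (supp_fun (K i) v - supp_fun (K i) y) < e" if "0 < e" for v e
  proof (intro exI conjI allI impI)
    show "0 < e / (R + 1)" using that R by simp
    fix i y assume "y \<in> Sph \<and> norm (v - y) < e / (R + 1)"
    then have "R * norm (v - y) \<le> R * (e / (R + 1))" using R by (intro mult_left_mono) auto
    also have "\<dots> < e" using that R by (simp add: field_simps)
    finally have "R * norm (v - y) < e" .
    then show "norm (supp_fun (K i) v - supp_fun (K i) y) < e" using lip[of i v y] by simp
  qed
  obtain h and \<sigma> :: "nat \<Rightarrow> nat" where h: "continuous_on Sph h" "strict_mono \<sigma>"
    "\<And>e. 0 < e \<Longrightarrow> \<exists>N. \<forall>i v. N \<le> i \<and> v \<in> Sph \<longrightarrow> norm (supp_fun (K (\<sigma> i)) v - h v) < e"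
    by (rule Arzela_Ascoli[of Sph "\<lambda>i. supp_fun (K i)" R]) (use compact_sphere bound equicont in blast)+
  have "(\<lambda>i. supp_fun (K (\<sigma> i)) v) \<longlonglongrightarrow> h v" if "v \<in> Sph" for v
  proof (rule LIMSEQ_I)
    fix e :: real assume "0 < e"
    then obtain N where "\<forall>i v. N \<le> i \<and> v \<in> Sph \<longrightarrow> norm (supp_fun (K (\<sigma> i)) v - h v) < e"
      using h(3) by blast
    then show "\<exists>N. \<forall>i\<ge>N. norm (supp_fun (K (\<sigma> i)) v - h v) < e" using that by blast
  qed
  with h(1,2) show ?thesis using that by blast
qed

lemma limit_supp_fun_in_Ce_plus:
  assumes K: "\<And>i. K i \<in> Ke" "\<And>i v. v \<in> Sph \<Longrightarrow> r \<le> supp_fun (K i) v" "0 < r"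
    and h: "continuous_on Sph h" "\<And>v. v \<in> Sph \<Longrightarrow> (\<lambda>i. supp_fun (K i) v) \<longlonglongrightarrow> h v"
  shows "h \<in> Ce_plus"
proof -
  have "r \<le> h v" if "v \<in> Sph" for v
    using h(2)[OF that] K(2)[OF that] by (intro LIMSEQ_le_const) auto
  moreover have "h (- v) = h v" if "v \<in> Sph" for v
  proof -
    have "(\<lambda>i. supp_fun (K i) (- v)) = (\<lambda>i. supp_fun (K i) v)"
      by (intro ext supp_fun_uminus) (use K(1) in \<open>auto simp: Ke_def\<close>)
    then show ?thesis using h(2)[OF that] h(2)[of "- v"] that LIMSEQ_unique by force
  qed
  ultimately show ?thesis using h(1) K(3) by (force simp: Ce_plus_def)
qed

section \<open>Mass of a continuous probability density\<close>

definition mass :: "('a::euclidean_space \<Rightarrow> real) \<Rightarrow> 'a set \<Rightarrow> real" where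
  "mass g A = (LINT x:A|lborel. g x)"

lemma mass_eq_integral: "mass g A = (\<integral>x. indicator A x * g x \<partial>lborel)"
  by (simp add: mass_def set_lebesgue_integral_def)

lemma Gmeas_eq_mass: "Gmeas \<alpha> q = mass (g_dens \<alpha> q)"
  by (simp add: fun_eq_iff Gmeas_def mass_def)

lemma hyperplane_null_sets:
  fixes l :: "'a::euclidean_space"
  assumes "l \<noteq> 0"
  shows "{x. x \<bullet> l = 0} \<in> null_sets lborel"
proof -
  have eq: "{x. x \<bullet> l = 0} = {x. l \<bullet> x = 0}" by (auto simp: inner_commute)
  have "negligible {x. l \<bullet> x = 0}" using negligible_hyperplane[of l 0] assms by simp
  then have "{x. l \<bullet> x = 0} \<in> null_sets lebesgue" by (simp add: negligible_iff_null_sets)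
  moreover have "{x. l \<bullet> x = 0} \<in> sets lborel"
    by (simp add: borel_closed closed_hyperplane)
  ultimately show ?thesis using eq null_sets_completion_iff by metis
qed

lemma lborel_integral_scaleR:
  fixes f :: "'a::euclidean_space \<Rightarrow> real"
  assumes t: "t \<noteq> 0" and f[measurable]: "f \<in> borel_measurable borel"
  shows "(\<integral>x. f x \<partial>lborel) = \<bar>t\<bar> ^ DIM('a) * (\<integral>x. f (t *\<^sub>R x) \<partial>lborel)"
proof -
  have "(\<integral>x. f x \<partial>lborel) =
      (\<integral>x. f x \<partial>(density (distr lborel borel (\<lambda>x. 0 + t *\<^sub>R x)) (\<lambda>_. \<bar>t\<bar>^DIM('a))))"
    by (rule arg_cong[where f="\<lambda>M. integral\<^sup>L M f"], rule lborel_affine[OF t])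
  also have "\<dots> = (\<integral>x. \<bar>t\<bar>^DIM('a) * f x \<partial>(distr lborel borel (\<lambda>x. 0 + t *\<^sub>R x)))"
    by (subst integral_density) auto
  also have "\<dots> = (\<integral>x. \<bar>t\<bar>^DIM('a) * f (t *\<^sub>R x) \<partial>lborel)"
    by (subst integral_distr) auto
  finally show ?thesis by simp
qed

lemma integrable_indicator_mult_compact:
  fixes A :: "'a::euclidean_space set"
  assumes "compact A"
  shows "integrable lborel (\<lambda>y. indicator A y * (C::real))"
proof -
  have "integrable lborel (indicator A :: 'a \<Rightarrow> real)"
    using emeasure_compact_finite[OF assms] borel_compact[OF assms]
    by (simp add: integrable_indicator_iff)
  then show ?thesis by (rule integrable_mult_left)
qed

lemma eventually_notin_shrinking_slabs:
  fixes u :: "nat \<Rightarrow> 'a::real_inner"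
  assumes "u \<longlonglongrightarrow> l" "w \<longlonglongrightarrow> 0" "x \<bullet> l \<noteq> 0"
  shows "eventually (\<lambda>k. x \<notin> {y. \<bar>y \<bullet> u k\<bar> \<le> w k}) sequentially"
proof -
  have "(\<lambda>k. \<bar>x \<bullet> u k\<bar>) \<longlonglongrightarrow> \<bar>x \<bullet> l\<bar>" using assms(1) by (intro tendsto_intros)
  then have "eventually (\<lambda>k. \<bar>x \<bullet> l\<bar> / 2 < \<bar>x \<bullet> u k\<bar>) sequentially"
    using assms(3) by (intro order_tendstoD) auto
  moreover have "eventually (\<lambda>k. w k < \<bar>x \<bullet> l\<bar> / 2) sequentially"
    using assms(2,3) by (intro order_tendstoD) auto
  ultimately show ?thesis by eventually_elim auto
qed

locale continuous_density =
  fixes g :: "'a::euclidean_space \<Rightarrow> real" and B :: real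
  assumes g_continuous: "continuous_on UNIV g"
    and g_nonneg: "\<And>x. 0 \<le> g x" and g_le: "\<And>x. g x \<le> B"
    and g_integrable: "integrable lborel g" and g_total: "integral\<^sup>L lborel g = 1"
begin

lemma borel_measurable_g[measurable]: "g \<in> borel_measurable borel"
  using g_continuous by (rule borel_measurable_continuous_onI)

lemma integrable_indicator_mult: "A \<in> sets borel \<Longrightarrow> integrable lborel (\<lambda>x. indicator A x * g x)"
  using integrable_real_mult_indicator[of A lborel g] g_integrable by (simp add: mult.commute)

lemma mass_mono:
  assumes "A \<subseteq> C" "A \<in> sets borel" "C \<in> sets borel"
  shows "mass g A \<le> mass g C"
  unfolding mass_eq_integral using assms
  by (intro integral_mono integrable_indicator_mult) (auto simp: g_nonneg indicator_def)

lemma mass_tendsto_dominated: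
  assumes "\<And>i. A i \<in> sets borel" "L \<in> sets borel"
    and "AE x in lborel. (\<lambda>i. indicator (A i) x :: real) \<longlonglongrightarrow> indicator L x"
  shows "(\<lambda>i. mass g (A i)) \<longlonglongrightarrow> mass g L"
  unfolding mass_eq_integral
proof (rule integral_dominated_convergence[where w=g])
  show "(\<lambda>x. indicator L x * g x) \<in> borel_measurable lborel"
    "\<And>i. (\<lambda>x. indicator (A i) x * g x) \<in> borel_measurable lborel"
    using assms(1,2) by measurable
  show "AE x in lborel. norm (indicator (A i) x * g x) \<le> g x" for i
    by (auto simp: g_nonneg indicator_def)
  show "AE x in lborel. (\<lambda>i. indicator (A i) x * g x) \<longlonglongrightarrow> indicator L x * g x"
    using assms(3) by eventually_elim (auto intro!: tendsto_intros)
qed (rule g_integrable)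

lemma mass_UNIV: "mass g UNIV = 1"
  using g_total by (simp add: mass_eq_integral)

lemma slab_mass_uniformly_small:
  assumes "0 < c"
  obtains r where "0 < r" "\<forall>u\<in>Sph. mass g {x. \<bar>x \<bullet> u\<bar> \<le> r} < c"
proof -
  have "\<exists>r>0. \<forall>u\<in>Sph. mass g {x. \<bar>x \<bullet> u\<bar> \<le> r} < c"
  proof (rule ccontr)
    assume "\<not> ?thesis"
    then have "\<forall>k::nat. \<exists>u\<in>Sph. c \<le> mass g {x. \<bar>x \<bullet> u\<bar> \<le> 1 / Suc k}"
      by (metis not_less of_nat_0_less_iff zero_less_Suc zero_less_divide_1_iff)
    then obtain u where u: "\<And>k. u k \<in> Sph" "\<And>k. c \<le> mass g {x. \<bar>x \<bullet> u k\<bar> \<le> 1 / Suc k}"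
      by metis
    obtain l \<sigma> where l: "l \<in> Sph" "strict_mono \<sigma>" "(u \<circ> \<sigma>) \<longlonglongrightarrow> l"
      using compact_sphere[of "0::'a" 1] u(1)
      unfolding compact_eq_seq_compact_metric seq_compact_def by metis
    define S where "S k = {x. \<bar>x \<bullet> u (\<sigma> k)\<bar> \<le> 1 / Suc (\<sigma> k)}" for k
    have "S k \<in> sets borel" for k
      unfolding S_def by (intro borel_closed closed_Collect_le) (auto intro!: continuous_intros)
    moreover have "AE x in lborel. (\<lambda>k. indicator (S k) x :: real) \<longlonglongrightarrow> indicator {} x"
    proof -
      have "l \<noteq> 0" using l(1) by auto
      then have "AE x in lborel. x \<notin> {x. x \<bullet> l = 0}"
        by (intro AE_not_in hyperplane_null_sets)
      then show ?thesis
      proof eventually_elim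
        case (elim x)
        have "(\<lambda>k. 1 / real (Suc (\<sigma> k))) \<longlonglongrightarrow> 0"
          using LIMSEQ_subseq_LIMSEQ[OF LIMSEQ_Suc[OF lim_const_over_n[of 1]] l(2)]
          by (simp add: o_def)
        then have "eventually (\<lambda>k. x \<notin> S k) sequentially"
          unfolding S_def using l(3) elim
          by (intro eventually_notin_shrinking_slabs[where l=l]) (simp_all add: o_def)
        then have "eventually (\<lambda>k. indicator (S k) x = (0::real)) sequentially"
          by (rule eventually_mono) simp
        then show "(\<lambda>k. indicator (S k) x :: real) \<longlonglongrightarrow> indicator {} x"
          by (simp add: tendsto_eventually)
      qed
    qed
    ultimately have "(\<lambda>k. mass g (S k)) \<longlonglongrightarrow> mass g {}"
      by (intro mass_tendsto_dominated) auto
    moreover have "\<forall>k. c \<le> mass g (S k)" using u(2) by (simp add: S_def)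
    moreover have "mass g {} = 0" by (simp add: mass_eq_integral)
    ultimately have "c \<le> 0" using LIMSEQ_le_const by metis
    then show False using assms by simp
  qed
  then show ?thesis using that by blast
qed

lemma supp_fun_uniform_lower_bound:
  assumes "0 < c"
  obtains r where "0 < r" "\<forall>K\<in>Ke. c \<le> mass g K \<longrightarrow> (\<forall>v\<in>Sph. r \<le> supp_fun K v)"
proof -
  obtain r where r: "0 < r" "\<forall>u\<in>Sph. mass g {x. \<bar>x \<bullet> u\<bar> \<le> r} < c"
    using slab_mass_uniformly_small[OF assms] by blast
  have "r \<le> supp_fun K v" if K: "K \<in> Ke" "c \<le> mass g K" and v: "v \<in> Sph" for K v
  proof (rule ccontr)
    assume "\<not> r \<le> supp_fun K v"
    have bK: "bounded K" "uminus ` K = K" "K \<in> sets borel"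
      using K(1) by (auto simp: Ke_def compact_imp_bounded borel_compact)
    have "K \<subseteq> {x. \<bar>x \<bullet> v\<bar> \<le> r}"
    proof
      fix x assume "x \<in> K"
      moreover have "- x \<in> K" using \<open>x \<in> K\<close> bK(2) by force
      ultimately have "x \<bullet> v \<le> supp_fun K v" "(- x) \<bullet> v \<le> supp_fun K v"
        using supp_fun_upper[OF bK(1)] by blast+
      then show "x \<in> {x. \<bar>x \<bullet> v\<bar> \<le> r}" using \<open>\<not> r \<le> supp_fun K v\<close> by auto
    qed
    moreover have "{x. \<bar>x \<bullet> v\<bar> \<le> r} \<in> sets borel"
      by (intro borel_closed closed_Collect_le) (auto intro!: continuous_intros)
    ultimately have "mass g K \<le> mass g {x. \<bar>x \<bullet> v\<bar> \<le> r}"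
      using bK(3) by (intro mass_mono)
    then show False using r(2) v K(2) by fastforce
  qed
  then show ?thesis using that r(1) by blast
qed

lemma mass_upper_semicontinuous:
  assumes "\<And>i. K i \<in> sets borel" "L \<in> sets borel"
    and "\<And>x. x \<notin> L \<Longrightarrow> eventually (\<lambda>i. x \<notin> K i) sequentially"
    and "\<And>i. c \<le> mass g (K i)"
  shows "c \<le> mass g L"
proof -
  have "AE x in lborel. (\<lambda>i. indicator (K i \<union> L) x :: real) \<longlonglongrightarrow> indicator L x"
  proof (rule AE_I2)
    fix x
    show "(\<lambda>i. indicator (K i \<union> L) x :: real) \<longlonglongrightarrow> indicator L x"
    proof (cases "x \<in> L")
      case False
      have "eventually (\<lambda>i. indicator (K i \<union> L) x = (indicator L x :: real)) sequentially"
        using assms(3)[OF False] by (rule eventually_mono) (use False in \<open>simp add: indicator_def\<close>)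
      then show ?thesis by (rule tendsto_eventually)
    qed (simp add: indicator_def)
  qed
  then have lim: "(\<lambda>i. mass g (K i \<union> L)) \<longlonglongrightarrow> mass g L"
    using assms(1,2) by (intro mass_tendsto_dominated) auto
  have "c \<le> mass g (K i \<union> L)" for i
    using assms(4)[of i] mass_mono[of "K i" "K i \<union> L"] assms(1,2) by force
  then show ?thesis using LIMSEQ_le_const[OF lim] by blast
qed

lemma mass_wulff_limit_ge:
  assumes K: "\<And>i. K i \<in> Ke" "\<And>i. c \<le> mass g (K i)"
    and lim: "\<And>v. v \<in> Sph \<Longrightarrow> (\<lambda>i. supp_fun (K i) v) \<longlonglongrightarrow> h v"
  shows "c \<le> mass g (wulff h)"
proof (rule mass_upper_semicontinuous[OF _ _ _ K(2)])
  show "K i \<in> sets borel" for i using K(1) by (simp add: Ke_def borel_compact)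
  show "wulff h \<in> sets borel" by (rule borel_closed[OF closed_wulff])
  fix x assume "x \<notin> wulff h"
  then obtain v where v: "v \<in> Sph" "h v < x \<bullet> v" by (auto simp: wulff_def not_le)
  have "eventually (\<lambda>i. supp_fun (K i) v < x \<bullet> v) sequentially"
    using lim[OF v(1)] v(2) by (rule order_tendstoD)
  then show "eventually (\<lambda>i. x \<notin> K i) sequentially"
  proof eventually_elim
    case (elim i)
    have "bounded (K i)" using K(1) by (simp add: Ke_def compact_imp_bounded)
    then show "x \<notin> K i" using supp_fun_upper[of "K i" x v] elim by force
  qed
qed

lemma exists_cball_mass_gt:
  assumes "c < 1"
  obtains T where "0 < T" "c < mass g (cball 0 T)"
proof -
  have "AE x in lborel. (\<lambda>k. indicator (cball (0::'a) (Suc k)) x :: real) \<longlonglongrightarrow> indicator UNIV x"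
  proof (rule AE_I2)
    fix x :: 'a
    obtain N :: nat where "norm x \<le> N" using real_arch_simple by blast
    then have "eventually (\<lambda>k. indicator (cball 0 (Suc k)) x = (1::real)) sequentially"
      by (intro eventually_sequentiallyI[of N]) (auto simp: indicator_def)
    then show "(\<lambda>k. indicator (cball 0 (Suc k)) x :: real) \<longlonglongrightarrow> indicator UNIV x"
      by (simp add: tendsto_eventually)
  qed
  then have "(\<lambda>k. mass g (cball 0 (Suc k))) \<longlonglongrightarrow> 1"
    using mass_tendsto_dominated[of "\<lambda>k. cball 0 (Suc k)" UNIV] mass_UNIV by simp
  then have "eventually (\<lambda>k. c < mass g (cball 0 (Suc k))) sequentially"
    using assms by (intro order_tendstoD) auto
  then obtain k where "c < mass g (cball 0 (Suc k))" by (auto dest: eventually_happens)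
  then show ?thesis using that[of "Suc k"] by simp
qed

lemma mass_scaleR:
  assumes "t \<noteq> 0" "compact A"
  shows "mass g ((*\<^sub>R) t ` A) = \<bar>t\<bar> ^ DIM('a) * (\<integral>y. indicator A y * g (t *\<^sub>R y) \<partial>lborel)"
proof -
  have "(*\<^sub>R) t ` A \<in> sets borel"
    using compact_scaling[OF assms(2), of t] by (intro borel_compact) simp
  then have "mass g ((*\<^sub>R) t ` A) =
      \<bar>t\<bar> ^ DIM('a) * (\<integral>y. indicator ((*\<^sub>R) t ` A) (t *\<^sub>R y) * g (t *\<^sub>R y) \<partial>lborel)"
    unfolding mass_eq_integral using assms(1)
    by (intro lborel_integral_scaleR borel_measurable_times borel_measurable_indicator borel_measurable_g)
  also have "(\<lambda>y. indicator ((*\<^sub>R) t ` A) (t *\<^sub>R y)) = (indicator A :: 'a \<Rightarrow> real)"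
    using assms(1) by (auto simp: indicator_def fun_eq_iff image_iff)
  finally show ?thesis by simp
qed

lemma continuous_on_integral_scaled:
  assumes "compact A"
  shows "continuous_on UNIV (\<lambda>t. \<integral>y. indicator A y * g (t *\<^sub>R y) \<partial>lborel)"
proof (rule continuous_on_sequentiallyI)
  have A: "A \<in> sets lborel" using assms by (simp add: borel_compact)
  fix u :: "nat \<Rightarrow> real" and a :: real assume "u \<longlonglongrightarrow> a"
  show "(\<lambda>n. \<integral>y. indicator A y * g (u n *\<^sub>R y) \<partial>lborel) \<longlonglongrightarrow> (\<integral>y. indicator A y * g (a *\<^sub>R y) \<partial>lborel)"
  proof (rule integral_dominated_convergence[where w="\<lambda>y. indicator A y * B"])
    show "integrable lborel (\<lambda>y. indicator A y * B)"
      by (rule integrable_indicator_mult_compact[OF assms])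
    show "AE y in lborel. norm (indicator A y * g (u n *\<^sub>R y)) \<le> indicator A y * B" for n
      by (auto simp: g_nonneg g_le indicator_def)
    have meas: "(\<lambda>y. indicator A y * g (t *\<^sub>R y)) \<in> borel_measurable lborel" for t
    proof -
      have "continuous_on UNIV (\<lambda>y. g (t *\<^sub>R y))"
        by (rule continuous_on_compose2[OF g_continuous]) (auto intro!: continuous_intros)
      then have "(\<lambda>y. g (t *\<^sub>R y)) \<in> borel_measurable lborel"
        using borel_measurable_continuous_onI by simp
      then show ?thesis by (intro borel_measurable_times borel_measurable_indicator A)
    qed
    then show "(\<lambda>y. indicator A y * g (a *\<^sub>R y)) \<in> borel_measurable lborel"
      "\<And>n. (\<lambda>y. indicator A y * g (u n *\<^sub>R y)) \<in> borel_measurable lborel" by auto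
    show "AE y in lborel. (\<lambda>n. indicator A y * g (u n *\<^sub>R y)) \<longlonglongrightarrow> indicator A y * g (a *\<^sub>R y)"
    proof (rule AE_I2)
      fix y
      have "isCont g (a *\<^sub>R y)" using g_continuous by (simp add: continuous_on_eq_continuous_at)
      moreover have "(\<lambda>n. u n *\<^sub>R y) \<longlonglongrightarrow> a *\<^sub>R y" using \<open>u \<longlonglongrightarrow> a\<close> by (intro tendsto_intros)
      ultimately have "(\<lambda>n. g (u n *\<^sub>R y)) \<longlonglongrightarrow> g (a *\<^sub>R y)" by (rule isCont_tendsto_compose)
      then show "(\<lambda>n. indicator A y * g (u n *\<^sub>R y)) \<longlonglongrightarrow> indicator A y * g (a *\<^sub>R y)"
        by (intro tendsto_intros)
    qed
  qed
qed

lemma exists_shrunk_mass_eq: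
  assumes "compact A" "0 < c" "c \<le> mass g A"
  obtains t where "0 < t" "t \<le> 1" "mass g ((*\<^sub>R) t ` A) = c"
proof -
  have A: "A \<in> sets borel" using assms(1) by (simp add: borel_compact)
  define \<phi> where "\<phi> t = t ^ DIM('a) * (\<integral>y. indicator A y * g (t *\<^sub>R y) \<partial>lborel)" for t :: real
  have mass_eq: "mass g ((*\<^sub>R) t ` A) = \<phi> t" if "0 < t" for t
    using mass_scaleR[of t A] that assms(1) by (simp add: \<phi>_def)
  have "continuous_on {0..1} \<phi>"
    unfolding \<phi>_def using continuous_on_integral_scaled[OF assms(1)]
    by (intro continuous_intros) (auto elim: continuous_on_subset)
  moreover have \<phi>0: "\<phi> 0 = 0" by (simp add: \<phi>_def zero_power[OF DIM_positive])
  moreover have "c \<le> \<phi> 1" using assms(3) mass_eq[of 1] by simp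
  ultimately obtain t where t: "0 \<le> t" "t \<le> 1" "\<phi> t = c"
    using IVT'[of \<phi> 0 c 1] assms(2) by auto
  moreover have "t \<noteq> 0" using t(3) assms(2) \<phi>0 by auto
  ultimately have "0 < t" by simp
  then show ?thesis using that[OF _ t(2)] mass_eq[of t] t(3) by simp
qed

lemma exists_cball_mass_eq:
  assumes "0 < c" "c < 1"
  obtains \<rho> where "0 < \<rho>" "mass g (cball 0 \<rho>) = c"
proof -
  obtain T where T: "0 < T" "c < mass g (cball 0 T)"
    using exists_cball_mass_gt[OF assms(2)] .
  obtain t where t: "0 < t" "t \<le> 1" "mass g ((*\<^sub>R) t ` cball 0 T) = c"
    by (rule exists_shrunk_mass_eq[OF compact_cball assms(1) less_imp_le[OF T(2)]])
  have "0 < t * T" using T(1) t(1) by simp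
  moreover have "mass g (cball 0 (t * T)) = c" using cball_scale[of t "0::'a" T] t by simp
  ultimately show ?thesis by (rule that)
qed

end

section \<open>Finite measures on the sphere\<close>

lemma filterlim_abs_inner_at_top:
  fixes x :: "'b \<Rightarrow> 'a::real_inner"
  assumes "filterlim (\<lambda>m. norm (x m)) at_top F" "((\<lambda>m. sgn (x m)) \<longlongrightarrow> l) F" "l \<bullet> v \<noteq> 0"
  shows "filterlim (\<lambda>m. \<bar>x m \<bullet> v\<bar>) at_top F"
proof -
  have "\<bar>x m \<bullet> v\<bar> = norm (x m) * \<bar>sgn (x m) \<bullet> v\<bar>" for m
    by (cases "x m = 0") (simp_all add: sgn_div_norm abs_mult)
  moreover have "filterlim (\<lambda>m. norm (x m) * \<bar>sgn (x m) \<bullet> v\<bar>) at_top F"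
    using assms by (intro filterlim_at_top_mult_tendsto_pos[where c="\<bar>l \<bullet> v\<bar>"] tendsto_intros) auto
  ultimately show ?thesis by simp
qed

locale finite_sphere_measure =
  fixes \<mu> :: "'a::euclidean_space measure"
  assumes sets_eq: "sets \<mu> = sets (restrict_space borel (Sph :: 'a set))"
    and emeasure_space_finite: "emeasure \<mu> (space \<mu>) < \<infinity>"
begin

sublocale finite_measure \<mu>
  using emeasure_space_finite by (intro finite_measureI) simp

lemma space_eq: "space \<mu> = Sph"
  using sets_eq_imp_space_eq[OF sets_eq] by (simp add: space_restrict_space)

lemma borel_measurable_continuous_on_sphere:
  fixes f :: "'a \<Rightarrow> real"
  assumes "continuous_on Sph f"
  shows "f \<in> borel_measurable \<mu>"
  using borel_measurable_continuous_on_restrict[OF assms] measurable_cong_sets[OF sets_eq refl]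
  by blast

lemma integrable_continuous_on_sphere:
  fixes f :: "'a \<Rightarrow> real"
  assumes "continuous_on Sph f"
  shows "integrable \<mu> f"
proof -
  obtain M where "\<forall>v\<in>Sph. norm (f v) \<le> M"
    using compact_imp_bounded[OF compact_continuous_image[OF assms compact_sphere]]
    by (auto simp: bounded_iff)
  then have "AE v in \<mu>. norm (f v) \<le> M" by (intro AE_I2) (simp add: space_eq)
  then show ?thesis
    by (intro integrable_const_bound[where B=M] borel_measurable_continuous_on_sphere assms)
qed

lemma integrable_powr:
  fixes f :: "'a \<Rightarrow> real"
  assumes "continuous_on Sph f" "\<forall>v\<in>Sph. 0 < f v"
  shows "integrable \<mu> (\<lambda>v. f v powr p)"
  using assms by (intro integrable_continuous_on_sphere continuous_on_powr continuous_on_const) auto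

lemma phi_antimono:
  fixes f h :: "'a \<Rightarrow> real"
  assumes "p < 0" "continuous_on Sph f" "continuous_on Sph h"
    and "\<forall>v\<in>Sph. 0 < f v" "\<forall>v\<in>Sph. f v \<le> h v"
  shows "phi p \<mu> h \<le> phi p \<mu> f"
proof -
  have "\<forall>v\<in>Sph. 0 < h v" using assms(4,5) by force
  then have "(\<integral>v. h v powr p \<partial>\<mu>) \<le> (\<integral>v. f v powr p \<partial>\<mu>)"
    using assms by (intro integral_mono_AE integrable_powr AE_I2) (auto simp: space_eq intro: powr_mono2')
  then have "- (1 / p) * (\<integral>v. h v powr p \<partial>\<mu>) \<le> - (1 / p) * (\<integral>v. f v powr p \<partial>\<mu>)"
    using assms(1) by (intro mult_left_mono) auto
  then show ?thesis unfolding phi_def .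
qed

lemma phi_const_pos:
  assumes "p < 0" "0 < \<rho>" "emeasure \<mu> (space \<mu>) \<noteq> 0"
  shows "0 < phi p \<mu> (\<lambda>_. \<rho>)"
proof -
  have "0 < measure \<mu> (space \<mu>)"
    using assms(3) emeasure_space_finite
    by (simp add: measure_def enn2real_positive_iff less_top[symmetric] zero_less_iff_neq_zero)
  then have "0 < measure \<mu> (space \<mu>) * \<rho> powr p" using assms(2) by simp
  then show ?thesis using assms(1) unfolding phi_def by (simp add: divide_pos_neg)
qed

lemma phi_tendsto:
  fixes H :: "nat \<Rightarrow> 'a \<Rightarrow> real"
  assumes "p < 0" "0 < r" "\<And>i. continuous_on Sph (H i)" "\<And>i v. v \<in> Sph \<Longrightarrow> r \<le> H i v"
    and "L \<in> borel_measurable \<mu>" "AE v in \<mu>. (\<lambda>i. H i v powr p) \<longlonglongrightarrow> L v"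
  shows "(\<lambda>i. phi p \<mu> (H i)) \<longlonglongrightarrow> - (1 / p) * (\<integral>v. L v \<partial>\<mu>)"
proof -
  have pos: "\<forall>v\<in>Sph. 0 < H i v" for i using assms(2,4) by (meson less_le_trans)
  have "(\<lambda>i. \<integral>v. H i v powr p \<partial>\<mu>) \<longlonglongrightarrow> (\<integral>v. L v \<partial>\<mu>)"
  proof (rule integral_dominated_convergence[where w="\<lambda>_. r powr p"])
    show "(\<lambda>v. H i v powr p) \<in> borel_measurable \<mu>" for i
      by (intro borel_measurable_integrable integrable_powr assms(3) pos)
    show "AE v in \<mu>. norm (H i v powr p) \<le> r powr p" for i
      using assms(1,2,4) by (intro AE_I2) (auto simp: space_eq intro: powr_mono2')
  qed (use assms(5,6) in auto)
  then show ?thesis unfolding phi_def by (intro tendsto_mult tendsto_const)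
qed

lemma phi_tendsto_continuous:
  fixes H :: "nat \<Rightarrow> 'a \<Rightarrow> real"
  assumes "p < 0" "0 < r" "\<And>i. continuous_on Sph (H i)" "\<And>i v. v \<in> Sph \<Longrightarrow> r \<le> H i v"
    and h: "continuous_on Sph h" "\<forall>v\<in>Sph. 0 < h v"
    and lim: "\<And>v. v \<in> Sph \<Longrightarrow> (\<lambda>i. H i v) \<longlonglongrightarrow> h v"
  shows "(\<lambda>i. phi p \<mu> (H i)) \<longlonglongrightarrow> phi p \<mu> h"
  unfolding phi_def[of p \<mu> h]
proof (rule phi_tendsto[OF assms(1-4)])
  show "(\<lambda>v. h v powr p) \<in> borel_measurable \<mu>"
    using h by (intro borel_measurable_integrable integrable_powr)
  show "AE v in \<mu>. (\<lambda>i. H i v powr p) \<longlonglongrightarrow> h v powr p"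
  proof (rule AE_I2)
    fix v assume "v \<in> space \<mu>"
    then have v: "v \<in> Sph" by (simp add: space_eq)
    then have "h v \<noteq> 0" using h(2) by force
    then show "(\<lambda>i. H i v powr p) \<longlonglongrightarrow> h v powr p"
      using lim[OF v] by (intro tendsto_powr tendsto_const)
  qed
qed

lemma great_subsphere_null_sets:
  assumes "\<forall>H. subspace H \<and> H \<noteq> UNIV \<longrightarrow> emeasure \<mu> (Sph \<inter> H) = 0" "l \<noteq> 0"
  shows "Sph \<inter> {v. v \<bullet> l = 0} \<in> null_sets \<mu>"
proof -
  have "l \<notin> {v. v \<bullet> l = 0}" using assms(2) by simp
  then have "emeasure \<mu> (Sph \<inter> {v. v \<bullet> l = 0}) = 0"
    using assms(1) subspace_hyperplane2[of l] by blast
  moreover have "{v. v \<bullet> l = 0} \<in> sets borel"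
    by (intro borel_closed closed_Collect_eq) (auto intro!: continuous_intros)
  then have "Sph \<inter> {v. v \<bullet> l = 0} \<in> sets \<mu>"
    unfolding sets_eq sets_restrict_space by blast
  ultimately show ?thesis by (simp add: null_sets_def)
qed

lemma phi_max_abs_inner_subseq_tendsto_0:
  fixes x :: "nat \<Rightarrow> 'a"
  assumes p: "p < 0" and r: "0 < r"
    and vanish: "\<forall>H. subspace H \<and> H \<noteq> UNIV \<longrightarrow> emeasure \<mu> (Sph \<inter> H) = 0"
    and x: "filterlim (\<lambda>m. norm (x m)) at_top sequentially" "\<And>m. x m \<noteq> 0"
  obtains \<sigma> :: "nat \<Rightarrow> nat"
  where "strict_mono \<sigma>" "(\<lambda>m. phi p \<mu> (\<lambda>v. max r \<bar>x (\<sigma> m) \<bullet> v\<bar>)) \<longlonglongrightarrow> 0"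
proof -
  have "sgn (x m) \<in> Sph" for m using x(2) by (simp add: norm_sgn)
  then obtain l \<sigma> where l: "l \<in> Sph" "strict_mono \<sigma>" "((\<lambda>m. sgn (x m)) \<circ> \<sigma>) \<longlonglongrightarrow> l"
    using compact_sphere[of "0::'a" 1]
    unfolding compact_eq_seq_compact_metric seq_compact_def by metis
  have norm_lim: "filterlim (\<lambda>m. norm (x (\<sigma> m))) at_top sequentially"
    using filterlim_compose[OF x(1) filterlim_subseq[OF l(2)]] .
  have "AE v in \<mu>. v \<notin> Sph \<inter> {v. v \<bullet> l = 0}"
    using l(1) by (intro AE_not_in great_subsphere_null_sets[OF vanish]) auto
  moreover note AE_space
  ultimately have "AE v in \<mu>. (\<lambda>m. max r \<bar>x (\<sigma> m) \<bullet> v\<bar> powr p) \<longlonglongrightarrow> 0"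
  proof eventually_elim
    case (elim v)
    then have "l \<bullet> v \<noteq> 0" by (simp add: space_eq inner_commute)
    then have "filterlim (\<lambda>m. \<bar>x (\<sigma> m) \<bullet> v\<bar>) at_top sequentially"
      using l(3) by (intro filterlim_abs_inner_at_top[OF norm_lim]) (simp_all add: o_def)
    then have "filterlim (\<lambda>m. max r \<bar>x (\<sigma> m) \<bullet> v\<bar>) at_top sequentially"
      by (rule filterlim_at_top_mono) simp
    with p show ?case by (rule tendsto_neg_powr)
  qed
  then have "(\<lambda>m. phi p \<mu> (\<lambda>v. max r \<bar>x (\<sigma> m) \<bullet> v\<bar>)) \<longlonglongrightarrow> - (1 / p) * (\<integral>v. 0 \<partial>\<mu>)"
    using r by (intro phi_tendsto[OF p r]) (auto intro!: continuous_intros)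
  then show ?thesis using that l(2) by simp
qed

lemma Ke_bounded_if_phi_bounded_below:
  assumes p: "p < 0" and r: "0 < r" and \<delta>: "0 < \<delta>"
    and vanish: "\<forall>H. subspace H \<and> H \<noteq> UNIV \<longrightarrow> emeasure \<mu> (Sph \<inter> H) = 0"
    and K: "\<And>i. K i \<in> Ke" "\<And>i v. v \<in> Sph \<Longrightarrow> r \<le> supp_fun (K i) v"
    and phi_K: "\<And>i. \<delta> \<le> phi p \<mu> (supp_fun (K i))"
  shows "\<exists>R. \<forall>i. K i \<subseteq> cball 0 R"
  proof (rule ccontr)
    assume unbounded: "\<not> (\<exists>R. \<forall>i. K i \<subseteq> cball 0 R)"
    have "\<exists>i y. y \<in> K i \<and> real m < norm y" for m :: nat
      using unbounded[unfolded not_ex, rule_format, of "real m"] by (auto simp: subset_iff not_le)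
    then obtain ii x where x: "\<And>m. x m \<in> K (ii m)" "\<And>m. real m < norm (x m)" by metis
    have "x m \<noteq> 0" for m using x(2)[of m] by auto
    moreover have "filterlim (\<lambda>m. norm (x m)) at_top sequentially"
      using x(2) by (intro filterlim_at_top_mono[OF filterlim_real_sequentially]
          always_eventually allI less_imp_le)
    ultimately obtain \<sigma> :: "nat \<Rightarrow> nat"
      where \<sigma>: "(\<lambda>m. phi p \<mu> (\<lambda>v. max r \<bar>x (\<sigma> m) \<bullet> v\<bar>)) \<longlonglongrightarrow> 0"
      using phi_max_abs_inner_subseq_tendsto_0[OF p r vanish] by blast
    have "\<delta> \<le> phi p \<mu> (\<lambda>v. max r \<bar>x (\<sigma> m) \<bullet> v\<bar>)" for m
    proof -
      let ?K = "K (ii (\<sigma> m))"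
      have K': "bounded ?K" "uminus ` ?K = ?K" "supp_fun ?K \<in> Ce_plus"
        using K(1)[of "ii (\<sigma> m)"] supp_fun_in_Ce_plus[OF K(1)] by (auto simp: Ke_def compact_imp_bounded)
      have "- x (\<sigma> m) \<in> ?K" using x(1) K'(2) by force
      then have "max r \<bar>x (\<sigma> m) \<bullet> v\<bar> \<le> supp_fun ?K v" if "v \<in> Sph" for v
        using supp_fun_upper[OF K'(1) x(1)] supp_fun_upper[OF K'(1) \<open>- x (\<sigma> m) \<in> ?K\<close>]
          K(2)[OF that] by (auto simp: abs_le_iff)
      then have "phi p \<mu> (supp_fun ?K) \<le> phi p \<mu> (\<lambda>v. max r \<bar>x (\<sigma> m) \<bullet> v\<bar>)"
        using K'(3) r by (intro phi_antimono[OF p]) (auto intro!: continuous_intros simp: Ce_plus_def)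
      then show ?thesis using phi_K order_trans by blast
    qed
    then have "\<delta> \<le> 0" using LIMSEQ_le_const[OF \<sigma>] by blast
    then show False using \<delta> by simp
  qed

end

section \<open>The density \<open>g\<^sub>\<alpha>\<^sub>,\<^sub>q\<close>\<close>

lemma one_plus_powr_le:
  fixes r \<alpha> :: real assumes r: "0 \<le> r" and a: "0 < \<alpha>"
  shows "(1 + r) powr \<alpha> \<le> 2 powr \<alpha> * (1 + r powr \<alpha>)"
proof (cases "r \<le> 1")
  case True
  have "(1 + r) powr \<alpha> \<le> 2 powr \<alpha>" using True r a by (intro powr_mono2) auto
  also have "\<dots> \<le> 2 powr \<alpha> * (1 + r powr \<alpha>)" by simp
  finally show ?thesis .
next
  case False
  have "(1 + r) powr \<alpha> \<le> (2 * r) powr \<alpha>" using False r a by (intro powr_mono2) auto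
  also have "\<dots> = 2 powr \<alpha> * r powr \<alpha>" using r by (simp add: powr_mult)
  also have "\<dots> \<le> 2 powr \<alpha> * (1 + r powr \<alpha>)" by simp
  finally show ?thesis .
qed

lemma one_plus_mult_powr_neg_le:
  fixes r \<alpha> a E D :: real
  assumes r: "0 \<le> r" and al: "0 < \<alpha>" and a: "0 < a" and E: "0 < E" and D: "D \<le> \<alpha> * E"
  shows "(1 + a * r powr \<alpha>) powr (- E) \<le> (min 1 a / 2 powr \<alpha>) powr (- E) * (1 + r) powr (- D)"
proof -
  define m where "m = min 1 a / 2 powr \<alpha>"
  have m: "0 < m" using a by (simp add: m_def)
  have "m * (1 + r) powr \<alpha> \<le> min 1 a / 2 powr \<alpha> * (2 powr \<alpha> * (1 + r powr \<alpha>))"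
    unfolding m_def using one_plus_powr_le[OF r al] a by (intro mult_left_mono) auto
  also have "\<dots> = min 1 a * (1 + r powr \<alpha>)" by simp
  also have "\<dots> \<le> 1 + a * r powr \<alpha>"
  proof -
    have "min 1 a * (1 + r powr \<alpha>) = min 1 a + min 1 a * r powr \<alpha>" by (simp add: algebra_simps)
    also have "\<dots> \<le> 1 + a * r powr \<alpha>"
      by (intro add_mono mult_right_mono) auto
    finally show ?thesis .
  qed
  finally have base: "m * (1 + r) powr \<alpha> \<le> 1 + a * r powr \<alpha>" .
  have pos: "0 < m * (1 + r) powr \<alpha>" using m r by simp
  have "m powr E * (1 + r) powr D \<le> m powr E * (1 + r) powr (\<alpha> * E)"
    using D r m by (intro mult_left_mono powr_mono) auto
  also have "\<dots> = (m * (1 + r) powr \<alpha>) powr E"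
    using m r by (simp add: powr_mult powr_powr)
  also have "\<dots> \<le> (1 + a * r powr \<alpha>) powr E"
    using base pos E by (intro powr_mono2) auto
  finally have ineq: "m powr E * (1 + r) powr D \<le> (1 + a * r powr \<alpha>) powr E" .
  have p1: "0 < m powr E * (1 + r) powr D" using m r by simp
  have "(1 + a * r powr \<alpha>) powr (- E) = 1 / (1 + a * r powr \<alpha>) powr E"
    by (simp add: powr_minus divide_inverse)
  also have "\<dots> \<le> 1 / (m powr E * (1 + r) powr D)"
  proof (rule divide_left_mono)
    show "m powr E * (1 + r) powr D \<le> (1 + a * r powr \<alpha>) powr E" by (rule ineq)
    have "0 < 1 + a * r powr \<alpha>" using a by (simp add: add_pos_nonneg)
    then have "0 < (1 + a * r powr \<alpha>) powr E" by simp
    then show "0 < (1 + a * r powr \<alpha>) powr E * (m powr E * (1 + r) powr D)"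
      using p1 by (rule mult_pos_pos)
  qed simp
  also have "\<dots> = m powr (- E) * (1 + r) powr (- D)"
    by (simp add: powr_minus divide_inverse)
  finally show ?thesis unfolding m_def .
qed

lemma one_plus_pow_le_exp:
  fixes y :: real and N :: nat assumes y: "0 \<le> y" and N: "1 \<le> N"
  shows "(1 + y) ^ N \<le> real N ^ N * exp y"
proof -
  have "1 + y \<le> real N * (1 + y / real N)" using N y by (simp add: field_simps)
  then have "(1 + y) ^ N \<le> (real N * (1 + y / real N)) ^ N" using y by (intro power_mono) auto
  also have "\<dots> = real N ^ N * (1 + y / real N) ^ N" by (simp add: power_mult_distrib)
  also have "\<dots> \<le> real N ^ N * exp (y / real N) ^ N"
    using y N by (intro mult_left_mono power_mono) (auto simp: exp_ge_add_one_self add_nonneg_nonneg)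
  also have "exp (y / real N) ^ N = exp y"
    using N by (simp add: exp_of_nat_mult[symmetric])
  finally show ?thesis .
qed

lemma exp_neg_powr_decay:
  fixes \<alpha> D :: real assumes al: "0 < \<alpha>" and D: "0 < D"
  shows "\<exists>C. \<forall>r\<ge>0. exp (- (r powr \<alpha>) / \<alpha>) \<le> C * (1 + r) powr (- D)"
proof -
  define N :: nat where "N = nat \<lceil>D / \<alpha>\<rceil> + 1"
  have N1: "1 \<le> N" by (simp add: N_def)
  have ND: "D \<le> \<alpha> * real N"
  proof -
    have "D / \<alpha> \<le> real N" unfolding N_def by linarith
    then show ?thesis using al by (simp add: field_simps)
  qed
  define K where "K = (2 powr \<alpha> * max 1 \<alpha> * real N) ^ N"
  have K: "0 < K" using N1 by (simp add: K_def)
  show ?thesis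
  proof (intro exI allI impI)
    fix r :: real assume r: "0 \<le> r"
    define y where "y = r powr \<alpha> / \<alpha>"
    have y: "0 \<le> y" using al by (simp add: y_def)
    have "(1 + r) powr D \<le> (1 + r) powr (\<alpha> * real N)" using ND r by (intro powr_mono) auto
    also have "\<dots> = ((1 + r) powr \<alpha>) ^ N"
      using r by (simp add: powr_powr[symmetric] powr_realpow)
    also have "\<dots> \<le> (2 powr \<alpha> * (1 + r powr \<alpha>)) ^ N"
      using one_plus_powr_le[OF r al] r by (intro power_mono) auto
    also have "1 + r powr \<alpha> \<le> max 1 \<alpha> * (1 + y)"
    proof -
      have "1 + r powr \<alpha> = 1 + \<alpha> * y" using al by (simp add: y_def)
      also have "\<dots> \<le> max 1 \<alpha> + max 1 \<alpha> * y" using y by (intro add_mono mult_right_mono) auto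
      finally show ?thesis by (simp add: algebra_simps)
    qed
    then have "(2 powr \<alpha> * (1 + r powr \<alpha>)) ^ N \<le> (2 powr \<alpha> * (max 1 \<alpha> * (1 + y))) ^ N"
      by (intro power_mono mult_left_mono) (auto intro: add_nonneg_nonneg)
    also have "\<dots> = (2 powr \<alpha> * max 1 \<alpha>) ^ N * (1 + y) ^ N"
      by (simp add: power_mult_distrib mult.assoc)
    also have "\<dots> \<le> (2 powr \<alpha> * max 1 \<alpha>) ^ N * (real N ^ N * exp y)"
      using one_plus_pow_le_exp[OF y N1] by (intro mult_left_mono) auto
    also have "\<dots> = K * exp y" by (simp add: K_def power_mult_distrib)
    finally have ineq: "(1 + r) powr D \<le> K * exp y" .
    have "exp (- (r powr \<alpha>) / \<alpha>) = 1 / exp y" by (simp add: y_def exp_minus divide_inverse)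
    also have "\<dots> \<le> K / (1 + r) powr D"
      using ineq r K by (simp add: field_simps)
    also have "\<dots> = K * (1 + r) powr (- D)" by (simp add: powr_minus divide_inverse)
    finally show "exp (- (r powr \<alpha>) / \<alpha>) \<le> K * (1 + r) powr (- D)" .
  qed
qed

lemma g_exponent_pos:
  fixes n \<alpha> q :: real
  assumes al: "0 < \<alpha>" and n: "0 \<le> n" and q: "0 < q" "q < \<alpha> / (n + \<alpha>)"
  shows "0 < 1 / q - n / \<alpha> - 1"
proof -
  have "q * (n + \<alpha>) < \<alpha>" using q al n by (simp add: less_divide_eq)
  then have "n + \<alpha> < \<alpha> / q" using q by (simp add: less_divide_eq mult.commute)
  then have "n / \<alpha> + 1 < 1 / q" using al q by (simp add: field_simps)
  then show ?thesis by simp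
qed

lemma one_le_one_minus_mult_powr:
  fixes q \<alpha> :: real
  assumes "q < 0" "0 < \<alpha>"
  shows "1 \<le> 1 - q / \<alpha> * norm x powr \<alpha>"
proof -
  have "q / \<alpha> \<le> 0" using assms by (simp add: divide_nonpos_pos)
  then have "q / \<alpha> * norm x powr \<alpha> \<le> 0" by (rule mult_nonpos_nonneg) simp
  then show ?thesis by simp
qed

lemma g_raw_nonneg: "0 \<le> g_raw \<alpha> q x"
  by (simp add: g_raw_def)

lemma g_raw_zero: "0 < \<alpha> \<Longrightarrow> g_raw \<alpha> q 0 = 1"
  by (simp add: g_raw_def)

lemma g_raw_le_1:
  fixes x :: "'a::euclidean_space"
  assumes al: "0 < \<alpha>" and q: "q < \<alpha> / (real DIM('a) + \<alpha>)"
  shows "g_raw \<alpha> q x \<le> 1"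
proof -
  define e where "e = 1 / q - real DIM('a) / \<alpha> - 1"
  consider "q = 0" | "0 < q" | "q < 0" by linarith
  then show ?thesis
  proof cases
    case 1 then show ?thesis using al by (simp add: g_raw_def)
  next
    case 2
    have e: "0 < e" unfolding e_def using g_exponent_pos[OF al _ 2 q] by simp
    have b: "\<bar>max 0 (1 - q / \<alpha> * norm x powr \<alpha>)\<bar> \<le> 1" using 2 al by auto
    show ?thesis using 2 powr_le1[OF _ b, of e] e by (simp add: g_raw_def e_def)
  next
    case 3
    have "1 / q < 0" using 3 by simp
    moreover have "0 \<le> real DIM('a) / \<alpha>" using al by simp
    ultimately have e: "e < 0" unfolding e_def by linarith
    have b1: "1 \<le> 1 - q / \<alpha> * norm x powr \<alpha>"
      using 3 al by (rule one_le_one_minus_mult_powr)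
    then have bm: "max 0 (1 - q / \<alpha> * norm x powr \<alpha>) = 1 - q / \<alpha> * norm x powr \<alpha>" by simp
    define X where "X = 1 - q / \<alpha> * norm x powr \<alpha>"
    have X1: "1 \<le> X" using b1 by (simp add: X_def)
    have "1 \<le> X powr (- e)" using X1 e by (intro ge_one_powr_ge_zero) auto
    moreover have "X powr e = inverse (X powr (- e))" using X1 by (simp add: powr_minus)
    ultimately have "X powr e \<le> inverse 1" by (metis le_imp_inverse_le zero_less_one)
    then have "(1 - q / \<alpha> * norm x powr \<alpha>) powr e \<le> 1" by (simp add: X_def)
    then show ?thesis using 3 bm by (simp add: g_raw_def e_def)
  qed
qed

lemma continuous_on_g_raw:
  assumes al: "0 < \<alpha>" and q: "q < \<alpha> / (real DIM('a) + \<alpha>)"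
  shows "continuous_on UNIV (g_raw \<alpha> q :: 'a::euclidean_space \<Rightarrow> real)"
proof -
  define e where "e = 1 / q - real DIM('a) / \<alpha> - 1"
  have np: "continuous_on UNIV (\<lambda>x::'a. norm x powr \<alpha>)"
    using al by (intro continuous_on_powr') (auto intro: continuous_intros)
  consider "q = 0" | "0 < q" | "q < 0" by linarith
  then show ?thesis
  proof cases
    case 1
    have "continuous_on UNIV (\<lambda>x::'a. exp (- (norm x powr \<alpha>) / \<alpha>))"
      using al by (intro continuous_on_exp continuous_on_divide continuous_on_minus np continuous_on_const) auto
    then show ?thesis using 1 by (simp add: g_raw_def[abs_def])
  next
    case 2
    have e: "0 < e" unfolding e_def using g_exponent_pos[OF al _ 2 q] by simp
    have "continuous_on UNIV (\<lambda>x::'a. (max 0 (1 - q / \<alpha> * norm x powr \<alpha>)) powr e)"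
      using np e al by (intro continuous_on_powr' continuous_intros) auto
    then show ?thesis using 2 by (simp add: g_raw_def[abs_def] e_def)
  next
    case 3
    have b1: "1 \<le> 1 - q / \<alpha> * norm x powr \<alpha>" for x :: 'a
      using 3 al by (rule one_le_one_minus_mult_powr)
    have nz0: "max 0 (1 - q / \<alpha> * norm x powr \<alpha>) \<noteq> 0" for x :: 'a
      using b1[of x] by linarith
    have nz: "\<forall>x::'a\<in>UNIV. max 0 (1 - q / \<alpha> * norm x powr \<alpha>) \<noteq> 0"
      using nz0 by blast
    have cb: "continuous_on UNIV (\<lambda>x::'a. max 0 (1 - q / \<alpha> * norm x powr \<alpha>))"
      by (intro continuous_on_max continuous_on_diff continuous_on_mult continuous_on_const np)
    have "continuous_on UNIV (\<lambda>x::'a. (max 0 (1 - q / \<alpha> * norm x powr \<alpha>)) powr e)"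
      by (rule continuous_on_powr[OF cb continuous_on_const nz])
    then show ?thesis using 3 by (simp add: g_raw_def[abs_def] e_def)
  qed
qed

lemma g_raw_decay_q_zero:
  assumes "0 < \<alpha>" "q = 0"
  shows "\<exists>C. \<forall>x::'a::euclidean_space. g_raw \<alpha> q x \<le> C * (1 + norm x) powr (- (real DIM('a) + \<alpha>))"
proof -
  obtain C where "\<forall>r\<ge>0. exp (- (r powr \<alpha>) / \<alpha>) \<le> C * (1 + r) powr (- (real DIM('a) + \<alpha>))"
    using exp_neg_powr_decay[of \<alpha> "real DIM('a) + \<alpha>"] assms(1) by auto
  then show ?thesis using assms(2) by (intro exI[of _ C]) (auto simp: g_raw_def)
qed

lemma g_raw_decay_q_pos:
  assumes al: "0 < \<alpha>" and q: "0 < q" "q < \<alpha> / (real DIM('a) + \<alpha>)"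
  shows "\<exists>C. \<forall>x::'a::euclidean_space. g_raw \<alpha> q x \<le> C * (1 + norm x) powr (- (real DIM('a) + \<alpha>))"
proof -
  define D where "D = real DIM('a) + \<alpha>"
  have D: "0 < D" using al by (simp add: D_def)
  define \<rho> where "\<rho> = (\<alpha> / q) powr (1 / \<alpha>)"
  have "g_raw \<alpha> q x \<le> (1 + \<rho>) powr D * (1 + norm x) powr (- D)" for x :: 'a
  proof (cases "norm x \<le> \<rho>")
    case True
    have pos: "0 < 1 + norm x" by (simp add: add_pos_nonneg)
    have "g_raw \<alpha> q x \<le> 1" using g_raw_le_1[OF al q(2)] by blast
    also have "1 = (1 + norm x) powr D * (1 + norm x) powr (- D)"
      using pos by (simp add: powr_add[symmetric])
    also have "\<dots> \<le> (1 + \<rho>) powr D * (1 + norm x) powr (- D)"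
      using True D by (intro mult_right_mono powr_mono2) auto
    finally show ?thesis .
  next
    case False
    then have "\<rho> powr \<alpha> < norm x powr \<alpha>" using al by (intro powr_less_mono2) (auto simp: \<rho>_def)
    moreover have "\<rho> powr \<alpha> = \<alpha> / q" using al q(1) by (simp add: \<rho>_def powr_powr)
    ultimately have "1 < q / \<alpha> * norm x powr \<alpha>" using al q(1) by (simp add: field_simps)
    then have "g_raw \<alpha> q x = 0" using q(1) by (simp add: g_raw_def)
    then show ?thesis by simp
  qed
  then show ?thesis unfolding D_def by blast
qed

lemma g_raw_decay_q_neg:
  assumes al: "0 < \<alpha>" and q: "q < 0"
  shows "\<exists>C. \<forall>x::'a::euclidean_space. g_raw \<alpha> q x \<le> C * (1 + norm x) powr (- (real DIM('a) + \<alpha>))"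
proof -
  define D where "D = real DIM('a) + \<alpha>"
  define a where "a = - q / \<alpha>"
  define E where "E = - (1 / q - real DIM('a) / \<alpha> - 1)"
  have a: "0 < a" using q al by (simp add: a_def divide_neg_pos)
  have "1 / q < 0" using q by simp
  moreover have "0 \<le> real DIM('a) / \<alpha>" using al by simp
  ultimately have E: "0 < E" unfolding E_def by linarith
  have "\<alpha> * E = - \<alpha> / q + real DIM('a) + \<alpha>" using al by (simp add: E_def field_simps)
  moreover have "0 < - \<alpha> / q" using q al by (simp add: divide_pos_neg)
  ultimately have DE: "D \<le> \<alpha> * E" by (simp add: D_def)
  have "g_raw \<alpha> q x \<le> (min 1 a / 2 powr \<alpha>) powr (- E) * (1 + norm x) powr (- D)" for x :: 'a
  proof -
    have "max 0 (1 - q / \<alpha> * norm x powr \<alpha>) = 1 + a * norm x powr \<alpha>"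
      using one_le_one_minus_mult_powr[OF q al, of x] by (simp add: a_def)
    then have "g_raw \<alpha> q x = (1 + a * norm x powr \<alpha>) powr (- E)"
      using q by (simp add: g_raw_def E_def)
    also have "\<dots> \<le> (min 1 a / 2 powr \<alpha>) powr (- E) * (1 + norm x) powr (- D)"
      by (rule one_plus_mult_powr_neg_le[OF _ al a E DE]) simp
    finally show ?thesis .
  qed
  then show ?thesis unfolding D_def by blast
qed

lemma g_raw_decay:
  assumes "0 < \<alpha>" and "q < \<alpha> / (real DIM('a) + \<alpha>)"
  shows "\<exists>C. \<forall>x::'a::euclidean_space. g_raw \<alpha> q x \<le> C * (1 + norm x) powr (- (real DIM('a) + \<alpha>))"
  using g_raw_decay_q_zero g_raw_decay_q_pos g_raw_decay_q_neg assms
  by (metis linorder_neqE_linordered_idom)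

lemma nn_integral_one_plus_abs_powr_finite:
  fixes \<delta> :: real assumes d: "0 < \<delta>"
  shows "(\<integral>\<^sup>+s. ennreal ((1 + \<bar>s\<bar>) powr (- (1 + \<delta>))) \<partial>lborel) < \<infinity>"
proof -
  define f where "f s = (1 + s) powr (- (1 + \<delta>))" for s :: real
  define F where "F s = - ((1 + s) powr (- \<delta>)) / \<delta>" for s :: real
  have fm[measurable]: "f \<in> borel_measurable borel" unfolding f_def by measurable
  have der: "DERIV F x :> f x" if "0 \<le> x" for x
  proof -
    have "DERIV (\<lambda>s. (1 + s) powr (- \<delta>)) x :> (- \<delta>) * (1 + x) powr (- \<delta> - 1)"
      using that by (auto intro!: derivative_eq_intros)
    then have "DERIV F x :> - ((- \<delta>) * (1 + x) powr (- \<delta> - 1)) / \<delta>"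
      unfolding F_def by (intro DERIV_cdivide DERIV_minus)
    moreover have "- ((- \<delta>) * (1 + x) powr (- \<delta> - 1)) / \<delta> = f x"
    proof -
      have "(1 + x) powr (- \<delta> - 1) = (1 + x) powr (- (1 + \<delta>))"
        by (rule arg_cong[where f="\<lambda>e. (1 + x) powr e"]) simp
      then show ?thesis using d unfolding f_def by simp
    qed
    ultimately show ?thesis by simp
  qed
  have lim: "(F \<longlongrightarrow> 0) at_top"
  proof -
    have "((\<lambda>s::real. (1 + s) powr (- \<delta>)) \<longlongrightarrow> 0) at_top"
      using d by (intro tendsto_neg_powr filterlim_tendsto_add_at_top[OF tendsto_const filterlim_ident]) auto
    then have "((\<lambda>s::real. - ((1 + s) powr (- \<delta>)) / \<delta>) \<longlongrightarrow> - 0 / \<delta>) at_top"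
      using d by (intro tendsto_divide tendsto_minus tendsto_const) auto
    then show ?thesis by (simp add: F_def[abs_def])
  qed
  have I: "(\<integral>\<^sup>+x. ennreal (f x) * indicator {0 ..} x \<partial>lborel) = 0 - F 0"
    by (rule nn_integral_FTC_atLeast[OF fm der _ lim]) (auto simp: f_def)
  then have I': "(\<integral>\<^sup>+x. ennreal (f x) * indicator {0 ..} x \<partial>lborel) < \<infinity>" by simp
  have I2: "(\<integral>\<^sup>+x. ennreal (f (- x)) * indicator {0 ..} (- x) \<partial>lborel) = (\<integral>\<^sup>+x. ennreal (f x) * indicator {0 ..} x \<partial>lborel)"
    using nn_integral_real_affine[of "\<lambda>x. ennreal (f x) * indicator {0 ..} x" "-1" 0] by simp
  have "(\<integral>\<^sup>+s. ennreal ((1 + \<bar>s\<bar>) powr (- (1 + \<delta>))) \<partial>lborel)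
      \<le> (\<integral>\<^sup>+x. ennreal (f x) * indicator {0 ..} x + ennreal (f (- x)) * indicator {0 ..} (- x) \<partial>lborel)"
    by (intro nn_integral_mono) (auto simp: f_def indicator_def)
  also have "\<dots> = (\<integral>\<^sup>+x. ennreal (f x) * indicator {0 ..} x \<partial>lborel) + (\<integral>\<^sup>+x. ennreal (f (- x)) * indicator {0 ..} (- x) \<partial>lborel)"
    by (intro nn_integral_add) auto
  also have "\<dots> < \<infinity>" using I' I2 by simp
  finally show ?thesis .
qed

lemma integrable_prod_one_plus_abs_powr:
  fixes \<delta> :: real
  assumes "0 < \<delta>"
  shows "integrable lborel (\<lambda>x::'a::euclidean_space. \<Prod>b\<in>Basis. (1 + \<bar>x \<bullet> b\<bar>) powr (- (1 + \<delta>)))"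
proof -
  define k where "k s = (1 + \<bar>s\<bar>) powr (- (1 + \<delta>))" for s :: real
  have k[measurable]: "k \<in> borel_measurable borel" unfolding k_def by measurable
  have k0: "0 \<le> k s" for s by (simp add: k_def)
  have "(\<integral>\<^sup>+x. ennreal (\<Prod>b\<in>Basis. k ((x::'a) \<bullet> b)) \<partial>lborel) =
      (\<integral>\<^sup>+x. (\<Prod>b\<in>Basis. ennreal (k ((x::'a) \<bullet> b))) \<partial>lborel)"
    by (simp add: prod_ennreal k0)
  also have "\<dots> = (\<Prod>b\<in>(Basis::'a set). (\<integral>\<^sup>+s. ennreal (k s) \<partial>lborel))"
    by (rule nn_integral_lborel_prod) auto
  also have "\<dots> < \<infinity>"
    using nn_integral_one_plus_abs_powr_finite[OF assms] unfolding k_def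
    by (simp add: power_less_top_ennreal)
  finally show ?thesis
    unfolding k_def[symmetric] by (intro integrableI_nonneg) (auto simp: k0 prod_nonneg)
qed

lemma one_plus_norm_powr_le_prod:
  fixes x :: "'a::euclidean_space" and \<delta> :: real
  assumes "0 < \<delta>"
  shows "(1 + norm x) powr (- (1 + \<delta>) * real DIM('a)) \<le> (\<Prod>b\<in>Basis. (1 + \<bar>x \<bullet> b\<bar>) powr (- (1 + \<delta>)))"
proof -
  have "0 < 1 + norm x" by (simp add: add_pos_nonneg)
  then have "(1 + norm x) powr (- (1 + \<delta>) * real DIM('a)) = ((1 + norm x) powr (- (1 + \<delta>))) ^ DIM('a)"
    by (simp add: powr_powr[symmetric] powr_realpow)
  also have "\<dots> = (\<Prod>b\<in>(Basis::'a set). (1 + norm x) powr (- (1 + \<delta>)))"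
    by simp
  also have "\<dots> \<le> (\<Prod>b\<in>Basis. (1 + \<bar>x \<bullet> b\<bar>) powr (- (1 + \<delta>)))"
    using Basis_le_norm assms by (intro prod_mono conjI powr_mono2') auto
  finally show ?thesis .
qed

lemma integrable_one_plus_norm_powr:
  assumes "0 < \<alpha>"
  shows "integrable lborel (\<lambda>x::'a::euclidean_space. (1 + norm x) powr (- (real DIM('a) + \<alpha>)))"
proof -
  define \<delta> where "\<delta> = \<alpha> / real DIM('a)"
  have \<delta>: "0 < \<delta>" using assms by (simp add: \<delta>_def)
  have exponent: "- (real DIM('a) + \<alpha>) = - (1 + \<delta>) * real DIM('a)"
    by (simp add: \<delta>_def field_simps)
  show ?thesis
  proof (rule Bochner_Integration.integrable_bound[OF integrable_prod_one_plus_abs_powr[OF \<delta>]])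
    show "AE x in lborel. norm ((1 + norm x) powr (- (real DIM('a) + \<alpha>)))
        \<le> norm (\<Prod>b\<in>Basis. (1 + \<bar>(x::'a) \<bullet> b\<bar>) powr (- (1 + \<delta>)))"
    proof (rule AE_I2)
      fix x :: 'a
      show "norm ((1 + norm x) powr (- (real DIM('a) + \<alpha>)))
          \<le> norm (\<Prod>b\<in>Basis. (1 + \<bar>x \<bullet> b\<bar>) powr (- (1 + \<delta>)))"
        using one_plus_norm_powr_le_prod[OF \<delta>, of x] unfolding exponent
        by (simp add: prod_nonneg)
    qed
  qed measurable
qed

lemma integrable_g_raw:
  assumes al: "0 < \<alpha>" and q: "q < \<alpha> / (real DIM('a) + \<alpha>)"
  shows "integrable lborel (g_raw \<alpha> q :: 'a::euclidean_space \<Rightarrow> real)"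
proof -
  obtain C where C: "\<And>x::'a. g_raw \<alpha> q x \<le> C * (1 + norm x) powr (- (real DIM('a) + \<alpha>))"
    using g_raw_decay[OF al q] by blast
  have Ci: "integrable lborel (\<lambda>x::'a. C * (1 + norm x) powr (- (real DIM('a) + \<alpha>)))"
    using integrable_one_plus_norm_powr[OF al] by (rule integrable_mult_right)
  show ?thesis
  proof (rule Bochner_Integration.integrable_bound[OF Ci])
    show "(g_raw \<alpha> q :: 'a \<Rightarrow> real) \<in> borel_measurable lborel"
      using continuous_on_g_raw[OF al q] borel_measurable_continuous_onI by simp
    show "AE x in lborel. norm (g_raw \<alpha> q x) \<le> norm (C * (1 + norm (x::'a)) powr (- (real DIM('a) + \<alpha>)))"
    proof (rule AE_I2)
      fix x :: 'a
      have "0 \<le> g_raw \<alpha> q x" by (rule g_raw_nonneg)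
      moreover have "g_raw \<alpha> q x \<le> C * (1 + norm x) powr (- (real DIM('a) + \<alpha>))" by (rule C)
      ultimately show "norm (g_raw \<alpha> q x) \<le> norm (C * (1 + norm x) powr (- (real DIM('a) + \<alpha>)))"
        by simp
    qed
  qed
qed

lemma Zc_pos:
  assumes "0 < \<alpha>" and "q < \<alpha> / (real DIM('a) + \<alpha>)"
  shows "0 < Zc \<alpha> q TYPE('a::euclidean_space)"
proof -
  have "isCont (g_raw \<alpha> q :: 'a \<Rightarrow> real) 0"
    using continuous_on_g_raw[OF assms] by (simp add: continuous_on_eq_continuous_at)
  moreover have g0: "g_raw \<alpha> q (0::'a) = 1" by (rule g_raw_zero[OF assms(1)])
  ultimately have "g_raw \<alpha> q \<midarrow>(0::'a)\<rightarrow> 1" by (simp add: isCont_def)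
  from LIM_D[OF this, of "1 / 2"] obtain e
    where e: "0 < e" "\<forall>x::'a. x \<noteq> 0 \<and> norm (x - 0) < e \<longrightarrow> norm (g_raw \<alpha> q x - 1) < 1 / 2"
    by auto
  have half: "1 / 2 < g_raw \<alpha> q x" if "norm x < e" for x :: 'a
  proof (cases "x = 0")
    case False
    then have "\<bar>g_raw \<alpha> q x - 1\<bar> < 1 / 2" using e(2) that by simp
    then show ?thesis by arith
  qed (simp add: g0)
  define B :: "'a set" where "B = cball 0 (e / 2)"
  have "(1 / 2) * measure lborel B = (\<integral>x. indicator B x * (1 / 2) \<partial>lborel)"
    using integrable_indicator_mult_compact[of B "1 / 2"] by (simp add: B_def)
  also have "\<dots> \<le> Zc \<alpha> q TYPE('a)"
    unfolding Zc_def
  proof (rule integral_mono)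
    show "integrable lborel (\<lambda>x. indicator B x * (1 / 2 :: real))"
      by (rule integrable_indicator_mult_compact) (simp add: B_def)
    show "integrable lborel (g_raw \<alpha> q :: 'a \<Rightarrow> real)" by (rule integrable_g_raw[OF assms])
    show "indicator B x * (1 / 2) \<le> g_raw \<alpha> q x" for x
    proof (cases "x \<in> B")
      case True
      then have "norm x < e" using e(1) by (simp add: B_def)
      then show ?thesis using half[of x] True by simp
    qed (simp add: g_raw_nonneg)
  qed
  finally have "1 / 2 * measure lborel B \<le> Zc \<alpha> q TYPE('a)" .
  moreover have "0 < measure lborel B"
    unfolding B_def by (rule content_cball_pos) (simp add: e(1))
  ultimately show ?thesis by simp
qed

lemma continuous_density_g_dens:
  assumes al: "0 < \<alpha>" and q: "q < \<alpha> / (real DIM('a) + \<alpha>)"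
  shows "continuous_density (g_dens \<alpha> q :: 'a::euclidean_space \<Rightarrow> real) (1 / Zc \<alpha> q TYPE('a))"
proof -
  have Z: "0 < Zc \<alpha> q TYPE('a)" by (rule Zc_pos[OF al q])
  have gd: "g_dens \<alpha> q = (\<lambda>x::'a. g_raw \<alpha> q x / Zc \<alpha> q TYPE('a))"
    by (simp add: g_dens_def[abs_def])
  show ?thesis
  proof
    show "continuous_on UNIV (g_dens \<alpha> q :: 'a \<Rightarrow> real)"
      unfolding gd using Z by (intro continuous_on_divide continuous_on_g_raw[OF al q] continuous_on_const) auto
    show "0 \<le> g_dens \<alpha> q (x::'a)" for x
      unfolding gd using Z by (intro divide_nonneg_pos g_raw_nonneg)
    show "g_dens \<alpha> q (x::'a) \<le> 1 / Zc \<alpha> q TYPE('a)" for x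
      unfolding gd using Z g_raw_le_1[OF al q, of x] by (simp add: divide_right_mono)
    show "integrable lborel (g_dens \<alpha> q :: 'a \<Rightarrow> real)"
      unfolding gd using integrable_g_raw[OF al q] by simp
    show "integral\<^sup>L lborel (g_dens \<alpha> q :: 'a \<Rightarrow> real) = 1"
      unfolding gd using Z by (simp add: Zc_def)
  qed
qed

section \<open>Existence of a maximizer\<close>

lemma cSUP_maximizing_sequence:
  fixes f :: "'b \<Rightarrow> real"
  assumes "A \<noteq> {}" "bdd_above (f ` A)" "0 < e"
  obtains F where "\<And>i. F i \<in> A" "\<And>i. (SUP a\<in>A. f a) - e < f (F i)"
    "(\<lambda>i. f (F i)) \<longlonglongrightarrow> (SUP a\<in>A. f a)"
proof -
  let ?S = "SUP a\<in>A. f a"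
  have "\<exists>a\<in>A. ?S - min e (1 / Suc i) < f a" for i :: nat
    using less_cSUP_iff[OF assms(1,2), of "?S - min e (1 / Suc i)"] assms(3) by simp
  then obtain F where F: "\<And>i. F i \<in> A" "\<And>i. ?S - min e (1 / Suc i) < f (F i)" by metis
  have "?S - e < f (F i)" for i using F(2)[of i] by linarith
  moreover have "(\<lambda>i. f (F i)) \<longlonglongrightarrow> ?S"
  proof (rule tendsto_sandwich[where f="\<lambda>i. ?S - 1 / Suc i" and h="\<lambda>_. ?S"])
    show "\<forall>\<^sub>F i in sequentially. ?S - 1 / Suc i \<le> f (F i)"
    proof (intro always_eventually allI)
      fix i
      have "min e (1 / Suc i) \<le> 1 / Suc i" by simp
      then show "?S - 1 / Suc i \<le> f (F i)" using F(2)[of i] by linarith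
    qed
    show "\<forall>\<^sub>F i in sequentially. f (F i) \<le> ?S"
      using F(1) assms(2) by (intro always_eventually allI) (simp add: cSUP_upper)
    show "(\<lambda>i. ?S - 1 / real (Suc i)) \<longlonglongrightarrow> ?S"
      using tendsto_diff[OF tendsto_const LIMSEQ_Suc[OF lim_const_over_n[of 1]]] by simp
  qed simp
  ultimately show ?thesis by (rule that[OF F(1)])
qed

locale support_maximization =
  continuous_density g B + finite_sphere_measure \<mu>
  for g :: "'a::euclidean_space \<Rightarrow> real" and B :: real and \<mu> :: "'a measure" +
  fixes p c :: real
  assumes p_neg: "p < 0" and c_pos: "0 < c" and c_less_1: "c < 1"
    and emeasure_space_nonzero: "emeasure \<mu> (space \<mu>) \<noteq> 0"
    and vanishes_on_great_subspheres: "\<forall>H. subspace H \<and> H \<noteq> UNIV \<longrightarrow> emeasure \<mu> (Sph \<inter> H) = 0"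
begin

definition feasible :: "('a \<Rightarrow> real) set" where
  "feasible = {f \<in> Ce_plus. mass g (wulff f) = c}"

definition phi_sup :: real where
  "phi_sup = (SUP f\<in>feasible. phi p \<mu> f)"

lemma supp_fun_feasible:
  assumes "K \<in> Ke" "mass g K = c"
  shows "supp_fun K \<in> feasible"
proof -
  have "K \<noteq> {}" using assms(1) by (rule Ke_nonempty)
  then have "wulff (supp_fun K) = K" using assms(1) by (intro wulff_supp_fun) (auto simp: Ke_def)
  then show ?thesis using assms supp_fun_in_Ce_plus by (simp add: feasible_def)
qed

lemma phi_le_phi_supp_fun_wulff:
  assumes "f \<in> feasible"
  shows "phi p \<mu> f \<le> phi p \<mu> (supp_fun (wulff f))"
proof -
  have f: "f \<in> Ce_plus" using assms by (simp add: feasible_def)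
  then have "supp_fun (wulff f) \<in> Ce_plus" by (intro supp_fun_in_Ce_plus wulff_in_Ke)
  moreover have "wulff f \<noteq> {}" using wulff_in_Ke[OF f] by (rule Ke_nonempty)
  ultimately show ?thesis
    using f supp_fun_wulff_le[OF \<open>wulff f \<noteq> {}\<close>]
    by (intro phi_antimono[OF p_neg]) (auto simp: Ce_plus_def)
qed

lemma feasible_lower_bound:
  obtains r where "0 < r" "\<forall>f\<in>feasible. \<forall>v\<in>Sph. r \<le> f v"
proof -
  obtain r where r: "0 < r" "\<forall>K\<in>Ke. c \<le> mass g K \<longrightarrow> (\<forall>v\<in>Sph. r \<le> supp_fun K v)"
    using supp_fun_uniform_lower_bound[OF c_pos] by blast
  have "r \<le> f v" if "f \<in> feasible" "v \<in> Sph" for f v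
  proof -
    have f: "f \<in> Ce_plus" "mass g (wulff f) = c" using that(1) by (auto simp: feasible_def)
    have "wulff f \<noteq> {}" using wulff_in_Ke[OF f(1)] by (rule Ke_nonempty)
    then show ?thesis
      using r(2) wulff_in_Ke[OF f(1)] f(2) supp_fun_wulff_le that(2) by fastforce
  qed
  then show ?thesis using that r(1) by blast
qed

lemma feasible_const:
  obtains \<rho> where "0 < \<rho>" "(\<lambda>_. \<rho>) \<in> feasible"
proof -
  obtain \<rho> where \<rho>: "0 < \<rho>" "mass g (cball 0 \<rho>) = c"
    using exists_cball_mass_eq[OF c_pos c_less_1] by blast
  moreover have "wulff (\<lambda>_::'a. \<rho>) = cball 0 \<rho>" using \<rho>(1) by (simp add: wulff_const)
  ultimately have "(\<lambda>_. \<rho>) \<in> feasible" by (simp add: feasible_def Ce_plus_def)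
  then show ?thesis using that \<rho>(1) by blast
qed

lemma bdd_above_phi_feasible: "bdd_above (phi p \<mu> ` feasible)"
proof -
  obtain r where r: "0 < r" "\<forall>f\<in>feasible. \<forall>v\<in>Sph. r \<le> f v"
    using feasible_lower_bound by blast
  have "phi p \<mu> f \<le> phi p \<mu> (\<lambda>_. r)" if "f \<in> feasible" for f
    using that r by (intro phi_antimono[OF p_neg]) (auto simp: feasible_def Ce_plus_def)
  then show ?thesis by (intro bdd_aboveI2)
qed

lemma phi_le_phi_sup: "f \<in> feasible \<Longrightarrow> phi p \<mu> f \<le> phi_sup"
  unfolding phi_sup_def by (rule cSUP_upper[OF _ bdd_above_phi_feasible])

lemma phi_sup_pos: "0 < phi_sup"
proof -
  obtain \<rho> where "0 < \<rho>" "(\<lambda>_. \<rho>) \<in> feasible" using feasible_const .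
  then show ?thesis
    using phi_const_pos[OF p_neg _ emeasure_space_nonzero] phi_le_phi_sup by fastforce
qed

lemma maximizing_bodies:
  obtains K where "\<And>i. K i \<in> Ke" "\<And>i. mass g (K i) = c"
    "\<And>i. phi_sup / 2 < phi p \<mu> (supp_fun (K i))"
    "(\<lambda>i. phi p \<mu> (supp_fun (K i))) \<longlonglongrightarrow> phi_sup"
proof -
  have "feasible \<noteq> {}" using feasible_const by blast
  then obtain F where F: "\<And>i. F i \<in> feasible" "\<And>i. phi_sup - phi_sup / 2 < phi p \<mu> (F i)"
    "(\<lambda>i. phi p \<mu> (F i)) \<longlonglongrightarrow> phi_sup"
    using cSUP_maximizing_sequence[OF _ bdd_above_phi_feasible half_gt_zero[OF phi_sup_pos],
        folded phi_sup_def]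
    by blast
  define K where "K i = wulff (F i)" for i
  have K: "K i \<in> Ke" "mass g (K i) = c" for i
    using F(1) wulff_in_Ke by (auto simp: K_def feasible_def)
  have le: "phi p \<mu> (F i) \<le> phi p \<mu> (supp_fun (K i))" for i
    unfolding K_def by (rule phi_le_phi_supp_fun_wulff[OF F(1)])
  have "(\<lambda>i. phi p \<mu> (supp_fun (K i))) \<longlonglongrightarrow> phi_sup"
    using le phi_le_phi_sup[OF supp_fun_feasible[OF K]]
    by (intro tendsto_sandwich[OF _ _ F(3) tendsto_const] always_eventually allI) auto
  moreover have "phi_sup / 2 < phi p \<mu> (supp_fun (K i))" for i
    using F(2)[of i] le[of i] by linarith
  ultimately show ?thesis using that K by blast
qed

lemma maximizing_limit:
  obtains h where "h \<in> Ce_plus" "c \<le> mass g (wulff h)" "phi_sup \<le> phi p \<mu> h"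
proof -
  obtain K where K: "\<And>i. K i \<in> Ke" "\<And>i. mass g (K i) = c"
    "\<And>i. phi_sup / 2 < phi p \<mu> (supp_fun (K i))"
    "(\<lambda>i. phi p \<mu> (supp_fun (K i))) \<longlonglongrightarrow> phi_sup"
    using maximizing_bodies by blast
  obtain r where r: "0 < r" "\<forall>K\<in>Ke. c \<le> mass g K \<longrightarrow> (\<forall>v\<in>Sph. r \<le> supp_fun K v)"
    using supp_fun_uniform_lower_bound[OF c_pos] by blast
  then have r_le: "r \<le> supp_fun (K i) v" if "v \<in> Sph" for i v using K(1,2) that by simp
  have \<delta>: "0 < phi_sup / 2" using phi_sup_pos by simp
  have phi_K: "phi_sup / 2 \<le> phi p \<mu> (supp_fun (K i))" for i using K(3) less_imp_le by blast
  have "\<exists>R. \<forall>i. K i \<subseteq> cball 0 R"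
    by (rule Ke_bounded_if_phi_bounded_below[where K=K and r=r and \<delta>="phi_sup / 2"])
       (fact p_neg r(1) \<delta> vanishes_on_great_subspheres K(1) r_le phi_K)+
  then obtain R where R: "\<And>i. K i \<subseteq> cball 0 R" by blast
  have nonempty: "K i \<noteq> {}" for i using K(1) by (rule Ke_nonempty)
  obtain h and \<sigma> :: "nat \<Rightarrow> nat" where h: "strict_mono \<sigma>" "continuous_on Sph h"
    "\<And>v. v \<in> Sph \<Longrightarrow> (\<lambda>i. supp_fun (K (\<sigma> i)) v) \<longlonglongrightarrow> h v"
    using supp_fun_subseq_tendsto[of K R, OF R nonempty] by blast
  have h_Ce: "h \<in> Ce_plus"
    using K(1) r(1) r_le h(2,3) by (intro limit_supp_fun_in_Ce_plus[of "K \<circ> \<sigma>" r]) auto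
  have "c \<le> mass g (wulff h)"
    using K(1,2) h(3) by (intro mass_wulff_limit_ge[of "K \<circ> \<sigma>"]) auto
  moreover have "(\<lambda>i. phi p \<mu> (supp_fun (K (\<sigma> i)))) \<longlonglongrightarrow> phi p \<mu> h"
  proof (rule phi_tendsto_continuous[OF p_neg r(1) _ r_le h(2) _ h(3)])
    show "continuous_on Sph (supp_fun (K (\<sigma> i)))" for i
      using supp_fun_in_Ce_plus[OF K(1)] by (simp add: Ce_plus_def)
    show "\<forall>v\<in>Sph. 0 < h v" using h_Ce by (simp add: Ce_plus_def)
  qed
  then have "phi p \<mu> h = phi_sup"
    using LIMSEQ_unique LIMSEQ_subseq_LIMSEQ[OF K(4) h(1)] by (auto simp: o_def)
  ultimately show ?thesis using that h_Ce by simp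
qed

lemma exists_maximizer:
  obtains K where "K \<in> Ke" "mass g K = c" "phi p \<mu> (supp_fun K) = phi_sup"
proof -
  obtain h where h: "h \<in> Ce_plus" "c \<le> mass g (wulff h)" "phi_sup \<le> phi p \<mu> h"
    using maximizing_limit by blast
  have "compact (wulff h)" using wulff_in_Ke[OF h(1)] by (simp add: Ke_def)
  then obtain t where t: "0 < t" "t \<le> 1" "mass g ((*\<^sub>R) t ` wulff h) = c"
    using exists_shrunk_mass_eq[OF _ c_pos h(2)] by blast
  define K where "K = wulff (\<lambda>v. t * h v)"
  have th: "(\<lambda>v. t * h v) \<in> Ce_plus"
    using h(1) t(1) by (auto simp: Ce_plus_def intro!: continuous_intros)
  have "K = (*\<^sub>R) t ` wulff h" unfolding K_def by (rule wulff_scaleR[OF t(1)])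
  then have K: "K \<in> Ke" "mass g K = c" using wulff_in_Ke[OF th] t(3) by (simp_all add: K_def)
  then have feasible: "supp_fun K \<in> feasible" by (rule supp_fun_feasible)
  have "K \<noteq> {}" using K(1) by (rule Ke_nonempty)
  have "supp_fun K v \<le> h v" if "v \<in> Sph" for v
  proof -
    have "supp_fun K v \<le> t * h v"
      using supp_fun_wulff_le[OF \<open>K \<noteq> {}\<close>[unfolded K_def] that] unfolding K_def .
    also have "\<dots> \<le> h v" using t(2) h(1) that by (simp add: Ce_plus_def)
    finally show ?thesis .
  qed
  then have "phi p \<mu> h \<le> phi p \<mu> (supp_fun K)"
    using supp_fun_in_Ce_plus[OF K(1)] h(1)
    by (intro phi_antimono[OF p_neg]) (auto simp: Ce_plus_def)
  then have "phi p \<mu> (supp_fun K) = phi_sup"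
    using h(3) phi_le_phi_sup[OF feasible] by simp
  then show ?thesis using that K by blast
qed

end

theorem lemma3p6:
  fixes \<mu> :: "'a::euclidean_space measure" and p \<alpha> q c :: real
  assumes "p < 0" and "\<alpha> > 0" and "q < \<alpha> / (real DIM('a) + \<alpha>)"
    and "sets \<mu> = sets (restrict_space borel (Sph :: 'a set))"
    and "emeasure \<mu> (space \<mu>) < \<infinity>"
    and "emeasure \<mu> (space \<mu>) \<noteq> 0"
    and "\<forall>A\<in>sets \<mu>. emeasure \<mu> (uminus ` A) = emeasure \<mu> A"
    and "\<forall>H. subspace H \<and> H \<noteq> UNIV \<longrightarrow> emeasure \<mu> (Sph \<inter> H) = 0"
    and "0 < c" and "c < 1"
  shows "\<exists>K\<in>Ke. Gmeas \<alpha> q K = c \<and>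
           phi p \<mu> (supp_fun K) = (SUP f\<in>{f\<in>Ce_plus. Gmeas \<alpha> q (wulff f) = c}. phi p \<mu> f) \<and>
           (\<forall>f\<in>Ce_plus. Gmeas \<alpha> q (wulff f) = c \<longrightarrow> phi p \<mu> f \<le> phi p \<mu> (supp_fun K))"
proof -
  interpret support_maximization "g_dens \<alpha> q :: 'a \<Rightarrow> real" "1 / Zc \<alpha> q TYPE('a)" \<mu> p c
  proof (intro support_maximization.intro finite_sphere_measure.intro
      support_maximization_axioms.intro)
    show "continuous_density (g_dens \<alpha> q :: 'a \<Rightarrow> real) (1 / Zc \<alpha> q TYPE('a))"
      by (rule continuous_density_g_dens[OF assms(2,3)])
  qed (use assms in auto)
  obtain K where K: "K \<in> Ke" "mass (g_dens \<alpha> q) K = c" "phi p \<mu> (supp_fun K) = phi_sup"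
    using exists_maximizer by blast
  have feasible_eq: "{f \<in> Ce_plus. Gmeas \<alpha> q (wulff f) = c} = feasible"
    by (simp add: feasible_def Gmeas_eq_mass)
  show ?thesis
  proof (intro bexI conjI ballI impI)
    show "Gmeas \<alpha> q K = c" using K(2) by (simp add: Gmeas_eq_mass)
    show "phi p \<mu> (supp_fun K) = (SUP f\<in>{f \<in> Ce_plus. Gmeas \<alpha> q (wulff f) = c}. phi p \<mu> f)"
      unfolding feasible_eq K(3) phi_sup_def ..
    fix f :: "'a \<Rightarrow> real" assume "f \<in> Ce_plus" "Gmeas \<alpha> q (wulff f) = c"
    then have "f \<in> feasible" using feasible_eq by blast
    then show "phi p \<mu> f \<le> phi p \<mu> (supp_fun K)" using phi_le_phi_sup K(3) by simp
  qed (rule K(1))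
qed

end
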